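(* Let $\mu\in M(\mathbb{T}^d)$ and let $\Lambda\subseteq\mathbb{Z}^d$ be a finite subset. Then \[ \|\widehat\mu\|_{\ell^\infty(\Lambda)}\leq\varepsilon(\mu,\Lambda)\leq\|\mu\|. \] Further, if there exists an extrapolation $\nu\in M(\mathbb{T}^d)$ of $\mu$ from $\Lambda$ with $\|\nu\|<\|\mu\|$, then \[ \|\widehat\mu\|_{\ell^\infty(\Lambda)}\leq\varepsilon(\mu,\Lambda)\leq\|\nu\|<\|\mu\|. \]
   Context: $\mathbb{T}^d=(\mathbb{R}/\mathbb{Z})^d$, and $M(\mathbb{T}^d)$ is the space of complex bounded Radon measures on $\mathbb{T}^d$ with the total variation norm $\|\cdot\|$. For $\mu\in M(\mathbb{T}^d)$ and $m\in\mathbb{Z}^d$, $\widehat\mu(m)=\int_{\mathbb{T}^d}e^{-2\pi i m\cdot x}\,d\mu(x)$, and $\|\widehat\mu\|_{\ell^\infty(\Lambda)}=\sup_{m\in\Lambda}|\widehat\mu(m)|$. A measure $\nu\in M(\mathbb{T}^d)$ is an extrapolation of $\mu$ from $\Lambda$ if $\widehat\nu=\widehat\mu$ on $\Lambda$. The quantity $\varepsilon(\mu,\Lambda)$ is the minimal norm of an extrapolation: $\varepsilon(\mu,\Lambda)=\min\{\|\nu\|\colon\nu\in M(\mathbb{T}^d),\ \widehat\nu=\widehat\mu\text{ on }\Lambda\}$ (the minimum is attained). *)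

theory Defs
  imports "HOL-Analysis.Analysis"
begin

section \<open>The torus\<close>

quotient_type circle = real / "\<lambda>x y. x - y \<in> \<int>"
proof (intro equivpI reflpI sympI transpI)
  fix x y z :: real
  show "x - x \<in> \<int>" by simp
  show "y - x \<in> \<int>" if "x - y \<in> \<int>"
    using Ints_minus[OF that] by simp
  show "x - z \<in> \<int>" if "x - y \<in> \<int>" "y - z \<in> \<int>"
    using Ints_add[OF that] by simp
qed

text \<open>The quotient topology. The torus of dimension \<open>CARD('d)\<close> is then the type
  \<open>circle ^ 'd\<close>, with the product topology provided by the library.\<close>

instantiation circle :: topological_space
begin

definition open_circle :: "circle set \<Rightarrow> bool" where
  "open_circle U \<longleftrightarrow> open (abs_circle -` U)"

instance
proof
  show "open (UNIV :: circle set)"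
    by (simp add: open_circle_def)
  show "open (S \<inter> T)" if "open S" "open T" for S T :: "circle set"
    using that by (simp add: open_circle_def open_Int)
  show "open (\<Union>K)" if "\<forall>S\<in>K. open S" for K :: "circle set set"
    using that by (auto simp: open_circle_def vimage_Union)
qed

end

section \<open>Complex measures\<close>

text \<open>The total variation \<open>|\<nu>|(E)\<close> of a Borel set function.\<close>

definition variation ::
    "('a::topological_space set \<Rightarrow> 'b::real_normed_vector) \<Rightarrow> 'a set \<Rightarrow> ennreal" where
  "variation \<nu> E =
    (SUP P\<in>{P. finite P \<and> P \<subseteq> sets borel \<and> partition_on E P}. \<Sum>A\<in>P. ennreal (norm (\<nu> A)))"

text \<open>Bounded complex Borel measures, as countably additive set functions (with the value \<open>0\<close>
  outside the Borel sets, so that equal measures are equal functions). On the torus, which is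
  compact and metrizable, every such measure is automatically Radon.\<close>

definition complex_measures :: "('a::topological_space set \<Rightarrow> complex) set" where
  "complex_measures = {\<nu>.
     (\<forall>A :: nat \<Rightarrow> 'a set. range A \<subseteq> sets borel \<longrightarrow> disjoint_family A \<longrightarrow>
        (\<lambda>n. \<nu> (A n)) sums \<nu> (\<Union>n. A n)) \<and>
     (\<forall>A. A \<notin> sets borel \<longrightarrow> \<nu> A = 0) \<and>
     variation \<nu> UNIV < \<infinity>}"

definition tv_norm :: "('a::topological_space set \<Rightarrow> complex) \<Rightarrow> real" where
  "tv_norm \<nu> = enn2real (variation \<nu> UNIV)"

text \<open>The Jordan decomposition \<open>\<rho> = \<rho>\<^sup>+ - \<rho>\<^sup>-\<close> of a real measure of finite variation is
  \<open>\<rho>\<^sup>+ = (|\<rho>| + \<rho>) / 2\<close>, \<open>\<rho>\<^sup>- = (|\<rho>| - \<rho>) / 2\<close>.\<close>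

definition pos_variation :: "('a::topological_space set \<Rightarrow> real) \<Rightarrow> 'a measure" where
  "pos_variation \<rho> =
     measure_of UNIV (sets borel) (\<lambda>E. ennreal ((enn2real (variation \<rho> E) + \<rho> E) / 2))"

definition neg_variation :: "('a::topological_space set \<Rightarrow> real) \<Rightarrow> 'a measure" where
  "neg_variation \<rho> =
     measure_of UNIV (sets borel) (\<lambda>E. ennreal ((enn2real (variation \<rho> E) - \<rho> E) / 2))"

definition complex_integral ::
    "('a::topological_space set \<Rightarrow> complex) \<Rightarrow> ('a \<Rightarrow> complex) \<Rightarrow> complex" where
  "complex_integral \<nu> f =
     (integral\<^sup>L (pos_variation (\<lambda>E. Re (\<nu> E))) f - integral\<^sup>L (neg_variation (\<lambda>E. Re (\<nu> E))) f)
     + \<i> * (integral\<^sup>L (pos_variation (\<lambda>E. Im (\<nu> E))) f - integral\<^sup>L (neg_variation (\<lambda>E. Im (\<nu> E))) f)"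

section \<open>Fourier coefficients and minimal extrapolation\<close>

text \<open>The function \<open>x \<mapsto> exp (-2\<pi>i m\<cdot>x)\<close>; by the lemma below, the choice of
  representatives of the coordinates of \<open>x\<close> is immaterial.\<close>

definition torus_char :: "int ^ 'd \<Rightarrow> circle ^ 'd \<Rightarrow> complex" where
  "torus_char m x =
     exp (- 2 * of_real pi * \<i> * of_real (\<Sum>j\<in>UNIV. of_int (m $ j) * rep_circle (x $ j)))"

lemma torus_char_abs_circle:
  "torus_char m (\<chi> j. abs_circle (t $ j)) =
     exp (- 2 * of_real pi * \<i> * of_real (\<Sum>j\<in>UNIV. of_int (m $ j) * (t $ j)))"
proof -
  have "rep_circle (abs_circle (t $ j)) - t $ j \<in> \<int>" for j
    using Quotient3_abs_rep[OF Quotient3_circle] by (simp flip: circle.abs_eq_iff)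
  then have "(\<Sum>j\<in>UNIV. of_int (m $ j) * (rep_circle (abs_circle (t $ j)) - t $ j)) \<in> \<int>"
    by (intro Ints_sum Ints_mult) auto
  then obtain k where
    k: "(\<Sum>j\<in>UNIV. of_int (m $ j) * (rep_circle (abs_circle (t $ j)) - t $ j)) = of_int k"
    by (elim Ints_cases)
  have eq: "(\<Sum>j\<in>UNIV. of_int (m $ j) * rep_circle (abs_circle (t $ j))) =
      (\<Sum>j\<in>UNIV. of_int (m $ j) * (t $ j)) + of_int k"
    unfolding k[symmetric] by (simp add: algebra_simps sum_subtractf)
  show ?thesis
    unfolding torus_char_def vec_lambda_beta eq
    by (rule exp_eq[THEN iffD2]) (auto intro!: exI[of _ "-k"] simp: algebra_simps)
qed

definition fourier_coeff :: "((circle ^ 'd) set \<Rightarrow> complex) \<Rightarrow> int ^ 'd \<Rightarrow> complex" where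
  "fourier_coeff \<mu> m = complex_integral \<mu> (torus_char m)"

text \<open>Inserting \<open>0\<close> only matters for empty \<open>\<Lambda>\<close>, where the norm is \<open>0\<close>.\<close>

definition linf_norm :: "'a set \<Rightarrow> ('a \<Rightarrow> complex) \<Rightarrow> real" where
  "linf_norm \<Lambda> f = Sup (insert 0 ((\<lambda>m. cmod (f m)) ` \<Lambda>))"

definition is_extrapolation ::
    "((circle ^ 'd) set \<Rightarrow> complex) \<Rightarrow> (int ^ 'd) set \<Rightarrow> ((circle ^ 'd) set \<Rightarrow> complex) \<Rightarrow> bool" where
  "is_extrapolation \<mu> \<Lambda> \<nu> \<longleftrightarrow>
     \<nu> \<in> complex_measures \<and> (\<forall>m\<in>\<Lambda>. fourier_coeff \<nu> m = fourier_coeff \<mu> m)"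

text \<open>A minimum of a set of reals, not just an infimum.\<close>

definition min_extrapolation_norm :: "((circle ^ 'd) set \<Rightarrow> complex) \<Rightarrow> (int ^ 'd) set \<Rightarrow> real" where
  "min_extrapolation_norm \<mu> \<Lambda> = (LEAST r. \<exists>\<nu>. is_extrapolation \<mu> \<Lambda> \<nu> \<and> r = tv_norm \<nu>)"

end

theory Submission
  imports Defs
begin

text \<open>The lower bound holds because a Fourier coefficient of a measure is at most its total variation, and
  an extrapolation shares the coefficients of \<open>\<mu>\<close> on \<open>\<Lambda>\<close>. The upper bounds hold because \<open>\<mu>\<close> and \<open>\<nu>\<close> are
  among the competitors. What needs an argument is that the minimum is attained: otherwise
  \<^const>\<open>min_extrapolation_norm\<close>, a least element, would not be the minimal norm.

  The usual argument takes a weak-* limit of a minimizing sequence. Since \<open>\<Lambda>\<close> is finite, everything can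
  instead be done in the finite-dimensional space \<open>\<complex>\<^sup>\<Lambda>\<close>. Let \<open>K\<close> be the convex hull of the vectors
  \<open>(c \<chi>\<^sub>m(x))\<close>, indexed by \<open>m \<in> \<Lambda>\<close>, for \<open>|c| \<le> 1\<close> and \<open>x\<close> in the torus, where \<open>\<chi>\<^sub>m\<close> is the character with
  frequency \<open>m\<close>. These are the coefficient vectors of point masses. Three facts about \<open>K\<close> are used.

  First, \<open>K\<close> is compact, by Caratheodory's theorem (\<open>compact_convex_hull_finite_span\<close>).
  Second, the coefficient vector of a measure of norm \<open>t\<close> is a limit of points of \<open>t K\<close>: collapse
  the measure to point masses on the members of a fine partition (\<open>fourier_coeff_approx_hull\<close>).
  Third, each point of \<open>r K\<close> is the coefficient vector of a discrete measure of norm at most \<open>r\<close>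
  (\<open>hull_point_measure\<close>).
  If \<open>r\<close> is the infimum of the norms of the extrapolations, the first two facts put the coefficient vector
  of \<open>\<mu>\<close> into \<open>r K\<close>, and the third yields a discrete minimizer. The second fact also gives the lower bound,
  since \<open>K\<close> lies in the unit ball of the maximum norm.

  To evaluate integrals against a complex measure, its variation is shown to be countably additive
  (\<open>variation_countably_additive\<close>), which turns the Jordan parts into measures. After that
  only one estimate by Riemann sums is needed (\<open>complex_integral_approx\<close>).\<close>

section \<open>The variation of a vector measure\<close>

text \<open>This is the countable additivity clause of \<^const>\<open>complex_measures\<close>, isolated so that it
  covers a complex measure and its real and imaginary parts alike.\<close>

definition vector_measure :: "('a::topological_space set \<Rightarrow> 'b::real_normed_vector) \<Rightarrow> bool" where
  "vector_measure \<rho> \<longleftrightarrow> (\<forall>A :: nat \<Rightarrow> 'a set. range A \<subseteq> sets borel \<longrightarrow> disjoint_family A \<longrightarrow>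
     (\<lambda>n. \<rho> (A n)) sums \<rho> (\<Union>n. A n))"

lemma vector_measure_empty:
  assumes "vector_measure \<rho>"
  shows "\<rho> {} = 0"
proof -
  have "(\<lambda>n::nat. \<rho> {}) sums \<rho> {}"
    using assms[unfolded vector_measure_def, rule_format, of "\<lambda>_. {}"]
    by (simp add: disjoint_family_on_def)
  then have "(\<lambda>n::nat. \<rho> {}) \<longlonglongrightarrow> 0"
    by (intro summable_LIMSEQ_zero) (auto simp: sums_iff)
  then show ?thesis by (simp add: LIMSEQ_const_iff)
qed

text \<open>An indexed family may contain the empty set several times and then is not a \<^const>\<open>partition_on\<close>;
  the empty members contribute nothing and can be dropped.\<close>

lemma sum_norm_le_variation:
  assumes \<rho>: "vector_measure \<rho>" and I: "finite I" "disjoint_family_on B I"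
    "\<And>i. i \<in> I \<Longrightarrow> B i \<in> sets borel" "(\<Union>i\<in>I. B i) = E"
  shows "(\<Sum>i\<in>I. ennreal (norm (\<rho> (B i)))) \<le> variation \<rho> E"
proof -
  define J where "J = {i\<in>I. B i \<noteq> {}}"
  have J: "J \<subseteq> I" "finite J" using I by (auto simp: J_def)
  have inj: "inj_on B J"
    using I(2) unfolding J_def disjoint_family_on_def inj_on_def by fastforce
  have part: "partition_on E (B ` J)"
  proof (rule partition_onI)
    show "\<Union>(B ` J) = E" using I(4) by (auto simp: J_def)
    show "disjnt p q" if "p \<in> B ` J" "q \<in> B ` J" "p \<noteq> q" for p q
      using that I(2) unfolding J_def disjoint_family_on_def disjnt_def by fastforce
  qed (auto simp: J_def)
  have "(\<Sum>i\<in>I. ennreal (norm (\<rho> (B i)))) = (\<Sum>i\<in>J. ennreal (norm (\<rho> (B i))))"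
    using I(1) vector_measure_empty[OF \<rho>] by (intro sum.mono_neutral_right) (auto simp: J_def)
  also have "\<dots> = (\<Sum>A\<in>B ` J. ennreal (norm (\<rho> A)))"
    by (simp add: sum.reindex[OF inj])
  also have "\<dots> \<le> variation \<rho> E"
    unfolding variation_def using part J I(3) by (intro SUP_upper) auto
  finally show ?thesis .
qed

lemma norm_le_variation:
  assumes "vector_measure \<rho>" "E \<in> sets borel"
  shows "ennreal (norm (\<rho> E)) \<le> variation \<rho> E"
  using sum_norm_le_variation[OF assms(1), of "{()}" "\<lambda>_. E" E] assms(2)
  by (simp add: disjoint_family_on_def)

text \<open>Partitions of \<open>E\<close> and \<open>F\<close> combine to one of \<open>E \<union> F\<close>; then take the two suprema one after the
  other.\<close>

lemma variation_superadditive: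
  assumes E: "E \<in> sets borel" "F \<in> sets borel" "E \<inter> F = {}"
  shows "variation \<rho> E + variation \<rho> F \<le> variation \<rho> (E \<union> F)"
proof -
  let ?\<P> = "\<lambda>E. {P. finite P \<and> P \<subseteq> sets borel \<and> partition_on E P}"
  let ?s = "\<lambda>P. \<Sum>A\<in>P. ennreal (norm (\<rho> A))"
  have ne: "?\<P> E \<noteq> {}" if "E \<in> sets borel" for E :: "'a set"
  proof (cases "E = {}")
    case True
    then have "{} \<in> ?\<P> E" by (simp add: partition_on_def)
    then show ?thesis by blast
  next
    case False
    then have "{E} \<in> ?\<P> E" using that by (auto simp: partition_on_def)
    then show ?thesis by blast
  qed
  have *: "?s P + ?s Q \<le> variation \<rho> (E \<union> F)" if P: "P \<in> ?\<P> E" and Q: "Q \<in> ?\<P> F" for P Q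
  proof -
    have "P \<inter> Q = {}"
    proof (rule ccontr)
      assume "P \<inter> Q \<noteq> {}"
      then obtain A where "A \<in> P" "A \<in> Q" by blast
      then have "A \<subseteq> E \<inter> F" "A \<noteq> {}" using P Q unfolding partition_on_def by blast+
      then show False using E(3) by simp
    qed
    then have "?s P + ?s Q = ?s (P \<union> Q)"
      using P Q by (subst sum.union_disjoint) auto
    also have "\<dots> \<le> variation \<rho> (E \<union> F)"
      unfolding variation_def
    proof (rule SUP_upper, simp, intro conjI)
      show "partition_on (E \<union> F) (P \<union> Q)"
      proof (rule partition_onI)
        show "\<Union>(P \<union> Q) = E \<union> F" using P Q by (auto simp: partition_on_def)
        show "{} \<notin> P \<union> Q" using P Q by (auto simp: partition_on_def)
        have sub: "A \<in> P \<Longrightarrow> A \<subseteq> E" "A \<in> Q \<Longrightarrow> A \<subseteq> F" for A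
          using P Q by (auto simp: partition_on_def)
        have disj: "disjoint P" "disjoint Q" using P Q by (auto simp: partition_on_def)
        show "disjnt A B" if AB: "A \<in> P \<union> Q" "B \<in> P \<union> Q" "A \<noteq> B" for A B
        proof -
          consider "A \<in> P" "B \<in> P" | "A \<in> Q" "B \<in> Q" | "A \<in> P" "B \<in> Q" | "A \<in> Q" "B \<in> P"
            using AB by blast
          then show ?thesis
            using disj AB(3) sub(1)[of A] sub(2)[of A] sub(1)[of B] sub(2)[of B] E(3)
            by cases (auto simp: disjnt_def disjoint_def)
        qed
      qed
    qed (use P Q in auto)
    finally show ?thesis .
  qed
  have "variation \<rho> E + ?s Q \<le> variation \<rho> (E \<union> F)" if "Q \<in> ?\<P> F" for Q
    unfolding variation_def[of \<rho> E]
    using * that ne[OF E(1)] by (subst ennreal_SUP_add_left[symmetric]) (auto intro!: SUP_least)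
  then have "?s Q + variation \<rho> E \<le> variation \<rho> (E \<union> F)" if "Q \<in> ?\<P> F" for Q
    using that by (simp only: add.commute)
  then have "variation \<rho> F + variation \<rho> E \<le> variation \<rho> (E \<union> F)"
    unfolding variation_def[of \<rho> F]
    using ne[OF E(2)] by (subst ennreal_SUP_add_left[symmetric]) (auto intro!: SUP_least)
  then show ?thesis by (simp only: add.commute)
qed

lemma variation_mono:
  assumes "E \<in> sets borel" "F \<in> sets borel" "E \<subseteq> F"
  shows "variation \<rho> E \<le> variation \<rho> F"
proof -
  have "variation \<rho> E \<le> variation \<rho> E + variation \<rho> (F - E)" by simp
  also have "\<dots> \<le> variation \<rho> (E \<union> (F - E))"
    using assms by (intro variation_superadditive) auto
  also have "E \<union> (F - E) = F" using assms by auto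
  finally show ?thesis .
qed

lemma ennreal_norm_le_suminf:
  assumes "f sums x"
  shows "ennreal (norm x) \<le> (\<Sum>n. ennreal (norm (f n)))"
proof (rule LIMSEQ_le_const2)
  show "(\<lambda>n. ennreal (norm (\<Sum>i<n. f i))) \<longlonglongrightarrow> ennreal (norm x)"
    using assms unfolding sums_def by (intro tendsto_ennrealI tendsto_norm)
  have "ennreal (norm (\<Sum>i<n. f i)) \<le> (\<Sum>n. ennreal (norm (f n)))" for n
  proof -
    have "ennreal (norm (\<Sum>i<n. f i)) \<le> ennreal (\<Sum>i<n. norm (f i))"
      by (intro ennreal_leI norm_sum)
    also have "\<dots> = (\<Sum>i<n. ennreal (norm (f i)))" by (simp add: sum_ennreal)
    also have "\<dots> \<le> (\<Sum>n. ennreal (norm (f n)))" by (intro sum_le_suminf) auto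
    finally show ?thesis .
  qed
  then show "\<exists>N. \<forall>n\<ge>N. ennreal (norm (\<Sum>i<n. f i)) \<le> (\<Sum>n. ennreal (norm (f n)))" by blast
qed

text \<open>One inequality is superadditivity applied to the first \<open>n\<close> sets. For the other, every member of a
  partition of the union is cut along the sets \<open>E n\<close>, and the sums over the pieces are regrouped by \<open>n\<close>.\<close>

lemma variation_countably_additive:
  fixes E :: "nat \<Rightarrow> 'a::topological_space set"
  assumes \<rho>: "vector_measure \<rho>" and E: "range E \<subseteq> sets borel" "disjoint_family E"
  shows "(\<Sum>n. variation \<rho> (E n)) = variation \<rho> (\<Union>n. E n)"
proof (rule antisym)
  have Eb: "E n \<in> sets borel" for n using E(1) by blast
  have fin: "(\<Sum>i<n. variation \<rho> (E i)) \<le> variation \<rho> (\<Union>i<n. E i)" for n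
  proof (induction n)
    case (Suc n)
    have "(\<Sum>i<Suc n. variation \<rho> (E i)) \<le> variation \<rho> (\<Union>i<n. E i) + variation \<rho> (E n)"
      using Suc by (simp add: add_right_mono)
    also have "\<dots> \<le> variation \<rho> ((\<Union>i<n. E i) \<union> E n)"
    proof (rule variation_superadditive)
      have "E i \<inter> E n = {}" if "i < n" for i
        using disjoint_family_onD[OF E(2), of i n] that by simp
      then show "(\<Union>i<n. E i) \<inter> E n = {}" by blast
    qed (use Eb in auto)
    also have "(\<Union>i<n. E i) \<union> E n = (\<Union>i<Suc n. E i)" by (auto simp: less_Suc_eq)
    finally show ?case .
  qed simp
  show "(\<Sum>n. variation \<rho> (E n)) \<le> variation \<rho> (\<Union>n. E n)"
  proof (rule suminf_le_const)
    fix n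
    have "variation \<rho> (\<Union>i<n. E i) \<le> variation \<rho> (\<Union>n. E n)"
      using Eb by (intro variation_mono) auto
    with fin[of n] show "(\<Sum>i<n. variation \<rho> (E i)) \<le> variation \<rho> (\<Union>n. E n)" by (rule order_trans)
  qed simp
  show "variation \<rho> (\<Union>n. E n) \<le> (\<Sum>n. variation \<rho> (E n))"
    unfolding variation_def[of \<rho> "\<Union>n. E n"]
  proof (rule SUP_least)
    fix P assume "P \<in> {P. finite P \<and> P \<subseteq> sets borel \<and> partition_on (\<Union>n. E n) P}"
    then have P: "finite P" "P \<subseteq> sets borel" "\<Union>P = (\<Union>n. E n)" "disjoint P"
      by (auto simp: partition_on_def)
    have cut: "(\<lambda>n. \<rho> (A \<inter> E n)) sums \<rho> A" if "A \<in> P" for A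
    proof -
      have "(\<Union>n. A \<inter> E n) = A" using that P(3) by blast
      moreover have "(\<lambda>n. \<rho> (A \<inter> E n)) sums \<rho> (\<Union>n. A \<inter> E n)"
      proof (rule \<rho>[unfolded vector_measure_def, rule_format])
        show "range (\<lambda>n. A \<inter> E n) \<subseteq> sets borel" using that P(2) Eb by auto
        show "disjoint_family (\<lambda>n. A \<inter> E n)"
          using E(2) by (rule disjoint_family_on_bisimulation) auto
      qed
      ultimately show ?thesis by simp
    qed
    have "(\<Sum>A\<in>P. ennreal (norm (\<rho> A))) \<le> (\<Sum>A\<in>P. \<Sum>n. ennreal (norm (\<rho> (A \<inter> E n))))"
      by (intro sum_mono ennreal_norm_le_suminf cut)
    also have "\<dots> = (\<Sum>n. \<Sum>A\<in>P. ennreal (norm (\<rho> (A \<inter> E n))))"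
      by (rule suminf_sum[symmetric]) simp
    also have "\<dots> \<le> (\<Sum>n. variation \<rho> (E n))"
    proof (rule suminf_le)
      fix n
      have "disjoint_family_on (\<lambda>A. A \<inter> E n) P"
        using P(4) unfolding disjoint_family_on_def disjoint_def by blast
      moreover have "(\<Union>A\<in>P. A \<inter> E n) = E n" using P(3) by blast
      moreover have "A \<inter> E n \<in> sets borel" if "A \<in> P" for A
        using that P(2) Eb by (intro sets.Int) auto
      ultimately show "(\<Sum>A\<in>P. ennreal (norm (\<rho> (A \<inter> E n)))) \<le> variation \<rho> (E n)"
        by (intro sum_norm_le_variation[OF \<rho> P(1)])
    qed simp_all
    finally show "(\<Sum>A\<in>P. ennreal (norm (\<rho> A))) \<le> (\<Sum>n. variation \<rho> (E n))" .
  qed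
qed

text \<open>The Jordan decomposition is defined through \<^const>\<open>measure_of\<close>, so its values are only available
  once \<open>(|\<rho>| \<plusminus> \<rho>) / 2\<close> is known to be nonnegative and countably additive.\<close>

lemma
  fixes \<rho> :: "'a::topological_space set \<Rightarrow> real"
  assumes \<rho>: "vector_measure \<rho>" and fin: "variation \<rho> UNIV < \<infinity>"
  shows sets_pos_variation: "sets (pos_variation \<rho>) = sets borel"
    and sets_neg_variation: "sets (neg_variation \<rho>) = sets borel"
    and emeasure_pos_variation: "E \<in> sets borel \<Longrightarrow>
      emeasure (pos_variation \<rho>) E = ennreal ((enn2real (variation \<rho> E) + \<rho> E) / 2)"
    and emeasure_neg_variation: "E \<in> sets borel \<Longrightarrow>
      emeasure (neg_variation \<rho>) E = ennreal ((enn2real (variation \<rho> E) - \<rho> E) / 2)"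
    and abs_le_variation: "E \<in> sets borel \<Longrightarrow> \<bar>\<rho> E\<bar> \<le> enn2real (variation \<rho> E)"
proof -
  have lt: "variation \<rho> E < \<infinity>" if "E \<in> sets borel" for E
    using variation_mono[of E UNIV \<rho>] fin that by auto
  have abs: "\<bar>\<rho> E\<bar> \<le> enn2real (variation \<rho> E)" if "E \<in> sets borel" for E
    using norm_le_variation[OF \<rho> that] lt[OF that]
    by (metis enn2real_ennreal enn2real_mono infinity_ennreal_def norm_ge_zero real_norm_def)
  have sums: "(\<lambda>n. enn2real (variation \<rho> (A n))) sums enn2real (variation \<rho> (\<Union>n. A n))"
    if A: "range A \<subseteq> sets borel" "disjoint_family A" for A :: "nat \<Rightarrow> 'a set"
  proof -
    have "A n \<in> sets borel" for n using A(1) by blast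
    then have eq: "ennreal (enn2real (variation \<rho> (A n))) = variation \<rho> (A n)" for n
      using lt[of "A n"] by simp
    have "ennreal (enn2real (variation \<rho> (\<Union>n. A n))) = variation \<rho> (\<Union>n. A n)"
      using lt[of "\<Union>n. A n"] A by auto
    then have "(\<lambda>n. ennreal (enn2real (variation \<rho> (A n)))) sums ennreal (enn2real (variation \<rho> (\<Union>n. A n)))"
      using variation_countably_additive[OF \<rho> A] by (simp add: eq sums_iff)
    then show ?thesis
      by (subst (asm) sums_ennreal) auto
  qed
  \<comment> \<open>Both parts at once: \<open>s = 1\<close> is the positive part, \<open>s = -1\<close> the negative part.\<close>
  have gen: "sets (measure_of UNIV (sets borel) (\<lambda>E. ennreal ((enn2real (variation \<rho> E) + s * \<rho> E) / 2))) = sets borel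
    \<and> (\<forall>E\<in>sets borel. emeasure (measure_of UNIV (sets borel) (\<lambda>E. ennreal ((enn2real (variation \<rho> E) + s * \<rho> E) / 2))) E
        = ennreal ((enn2real (variation \<rho> E) + s * \<rho> E) / 2))" if s: "s = 1 \<or> s = -1" for s
  proof -
    let ?M = "measure_of UNIV (sets borel) (\<lambda>E. ennreal ((enn2real (variation \<rho> E) + s * \<rho> E) / 2))"
    have sets: "sets ?M = sets borel"
      using sets.sigma_sets_eq[of "borel :: 'a measure"] by (simp add: sets_measure_of)
    have nonneg: "0 \<le> (enn2real (variation \<rho> E) + s * \<rho> E) / 2" if "E \<in> sets borel" for E
      using abs[OF that] s by auto
    have "emeasure ?M E = ennreal ((enn2real (variation \<rho> E) + s * \<rho> E) / 2)" if "E \<in> sets borel" for E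
    proof (rule emeasure_measure_of[where \<Omega>=UNIV and A="sets borel"])
      show "positive (sets ?M) (\<lambda>E. ennreal ((enn2real (variation \<rho> E) + s * \<rho> E) / 2))"
        using vector_measure_empty[OF \<rho>] sums[of "\<lambda>_. {}"]
        by (auto simp: positive_def variation_def partition_on_empty)
      show "countably_additive (sets ?M) (\<lambda>E. ennreal ((enn2real (variation \<rho> E) + s * \<rho> E) / 2))"
        unfolding sets countably_additive_def
      proof (intro allI impI suminf_ennreal_eq)
        fix A :: "nat \<Rightarrow> 'a set" assume A: "range A \<subseteq> sets borel" "disjoint_family A"
        show "(\<lambda>n. (enn2real (variation \<rho> (A n)) + s * \<rho> (A n)) / 2) sums
            ((enn2real (variation \<rho> (\<Union>n. A n)) + s * \<rho> (\<Union>n. A n)) / 2)"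
          using A \<rho>[unfolded vector_measure_def]
          by (intro sums_divide sums_add sums sums_mult) auto
        show "0 \<le> (enn2real (variation \<rho> (A n)) + s * \<rho> (A n)) / 2" for n
          using nonneg[of "A n"] A by auto
      qed
    qed (use that sets in auto)
    with sets show ?thesis by blast
  qed
  show "sets (pos_variation \<rho>) = sets borel" "sets (neg_variation \<rho>) = sets borel"
    using gen[of 1] gen[of "-1"] by (auto simp: pos_variation_def neg_variation_def)
  show "emeasure (pos_variation \<rho>) E = ennreal ((enn2real (variation \<rho> E) + \<rho> E) / 2)"
     "emeasure (neg_variation \<rho>) E = ennreal ((enn2real (variation \<rho> E) - \<rho> E) / 2)"
     "\<bar>\<rho> E\<bar> \<le> enn2real (variation \<rho> E)"
     if "E \<in> sets borel"
    using gen[of 1] gen[of "-1"] abs that by (auto simp: pos_variation_def neg_variation_def)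
qed

section \<open>Riemann sums for complex measures\<close>

text \<open>Here and below a finite Borel partition is given as the family of fibres of a map \<open>h\<close> with finite
  range, and \<open>a \<circ> h\<close> is the corresponding step function. The estimate is the integral of
  \<open>|f - a \<circ> h| \<le> e\<close>.\<close>

lemma integral_finite_partition_approx:
  fixes f :: "'a::topological_space \<Rightarrow> complex"
  assumes M: "sets M = sets borel" "emeasure M UNIV < \<infinity>"
    and f: "f \<in> borel_measurable borel"
    and h: "finite (range h)" "\<And>k. h -` {k} \<in> sets borel"
    and approx: "\<And>x. cmod (f x - a (h x)) \<le> e"
  shows "cmod (integral\<^sup>L M f - (\<Sum>k\<in>range h. measure M (h -` {k}) *\<^sub>R a k)) \<le> e * measure M UNIV"
proof -
  have sp: "space M = UNIV" using sets_eq_imp_space_eq[OF M(1)] by simp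
  interpret finite_measure M
    by standard (use M(2) sp in auto)
  have hM: "h -` {k} \<in> sets M" for k using h(2) M(1) by simp
  have fM: "f \<in> borel_measurable M" using f M(1) by (simp cong: measurable_cong_sets)
  have step: "(\<Sum>k\<in>range h. indicator (h -` {k}) x *\<^sub>R a k) = a (h x)" for x
    using h(1) by (simp add: indicator_def of_bool_def if_distrib if_distribR sum.If_cases
        sum.delta' cong: if_cong)
  have int_step: "integrable M (\<lambda>x. indicator (h -` {k}) x *\<^sub>R a k)" for k
    by (intro integrable_scaleR_left integrable_real_indicator hM) (simp add: less_top[symmetric])
  have int_a: "integrable M (\<lambda>x. a (h x))"
    unfolding step[symmetric] by (intro Bochner_Integration.integrable_sum int_step)
  \<comment> \<open>The crude bound makes \<open>f\<close> integrable for the finite measure \<open>M\<close>.\<close>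
  have "cmod (f x) \<le> e + (\<Sum>k\<in>range h. cmod (a k))" for x
  proof -
    have "cmod (f x) \<le> cmod (f x - a (h x)) + cmod (a (h x))"
      using norm_triangle_ineq[of "f x - a (h x)" "a (h x)"] by simp
    also have "cmod (a (h x)) \<le> (\<Sum>k\<in>range h. cmod (a k))"
      using h(1) by (intro member_le_sum) auto
    finally show ?thesis using approx[of x] by linarith
  qed
  then have int_f: "integrable M f"
    using fM by (intro integrable_const_bound[of _ "e + (\<Sum>k\<in>range h. cmod (a k))"]) auto
  have int_val: "integral\<^sup>L M (\<lambda>x. indicator (h -` {k}) x *\<^sub>R a k) = measure M (h -` {k}) *\<^sub>R a k" for k
    using hM[of k] by (subst integral_scaleR_left)
      (auto simp: sp less_top[symmetric] intro!: integrable_real_indicator)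
  have "integral\<^sup>L M (\<lambda>x. a (h x)) = (\<Sum>k\<in>range h. measure M (h -` {k}) *\<^sub>R a k)"
    unfolding step[symmetric] int_val[symmetric]
    by (intro Bochner_Integration.integral_sum int_step)
  then have "integral\<^sup>L M f - (\<Sum>k\<in>range h. measure M (h -` {k}) *\<^sub>R a k) = integral\<^sup>L M (\<lambda>x. f x - a (h x))"
    using int_f int_a by simp
  also have "cmod \<dots> \<le> integral\<^sup>L M (\<lambda>x. cmod (f x - a (h x)))"
    by (rule integral_norm_bound)
  also have "\<dots> \<le> integral\<^sup>L M (\<lambda>x. e)"
    using int_f int_a approx by (intro integral_mono) auto
  also have "\<dots> = e * measure M UNIV" by (simp add: sp)
  finally show ?thesis .
qed

text \<open>Apply the estimate to the positive and the negative part: their difference is \<open>\<rho>\<close>, and their total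
  masses add up to the variation of \<open>\<rho>\<close>.\<close>

lemma jordan_integral_approx:
  fixes \<rho> :: "'a::topological_space set \<Rightarrow> real"
  assumes \<rho>: "vector_measure \<rho>" and fin: "variation \<rho> UNIV < \<infinity>"
    and f: "f \<in> borel_measurable borel"
    and h: "finite (range h)" "\<And>k. h -` {k} \<in> sets borel"
    and approx: "\<And>x. cmod (f x - a (h x)) \<le> e"
  shows "cmod (integral\<^sup>L (pos_variation \<rho>) f - integral\<^sup>L (neg_variation \<rho>) f
      - (\<Sum>k\<in>range h. of_real (\<rho> (h -` {k})) * a k)) \<le> e * enn2real (variation \<rho> UNIV)"
proof -
  let ?P = "pos_variation \<rho>" and ?N = "neg_variation \<rho>"
  have meas: "measure ?P E = (enn2real (variation \<rho> E) + \<rho> E) / 2"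
    "measure ?N E = (enn2real (variation \<rho> E) - \<rho> E) / 2" if "E \<in> sets borel" for E
    using emeasure_pos_variation[OF \<rho> fin that] emeasure_neg_variation[OF \<rho> fin that]
      abs_le_variation[OF \<rho> fin that] by (auto simp: measure_def)
  have diff: "measure ?P (h -` {k}) - measure ?N (h -` {k}) = \<rho> (h -` {k})" for k
    unfolding meas[OF h(2)] by (simp add: field_simps)
  have P: "cmod (integral\<^sup>L ?P f - (\<Sum>k\<in>range h. measure ?P (h -` {k}) *\<^sub>R a k)) \<le> e * measure ?P UNIV"
    by (rule integral_finite_partition_approx[OF _ _ f h approx])
      (simp_all add: sets_pos_variation[OF \<rho> fin] emeasure_pos_variation[OF \<rho> fin])
  have N: "cmod (integral\<^sup>L ?N f - (\<Sum>k\<in>range h. measure ?N (h -` {k}) *\<^sub>R a k)) \<le> e * measure ?N UNIV"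
    by (rule integral_finite_partition_approx[OF _ _ f h approx])
      (simp_all add: sets_neg_variation[OF \<rho> fin] emeasure_neg_variation[OF \<rho> fin])
  have "(\<Sum>k\<in>range h. of_real (\<rho> (h -` {k})) * a k) =
      (\<Sum>k\<in>range h. measure ?P (h -` {k}) *\<^sub>R a k) - (\<Sum>k\<in>range h. measure ?N (h -` {k}) *\<^sub>R a k)"
    unfolding sum_subtractf[symmetric] scaleR_diff_left[symmetric] scaleR_conv_of_real[symmetric] diff ..
  then have "integral\<^sup>L ?P f - integral\<^sup>L ?N f - (\<Sum>k\<in>range h. of_real (\<rho> (h -` {k})) * a k) =
      (integral\<^sup>L ?P f - (\<Sum>k\<in>range h. measure ?P (h -` {k}) *\<^sub>R a k)) -
      (integral\<^sup>L ?N f - (\<Sum>k\<in>range h. measure ?N (h -` {k}) *\<^sub>R a k))" by simp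
  also have "cmod \<dots> \<le> e * measure ?P UNIV + e * measure ?N UNIV"
    by (rule order_trans[OF norm_triangle_ineq4 add_mono[OF P N]])
  also have "\<dots> = e * enn2real (variation \<rho> UNIV)"
    by (simp add: meas field_simps)
  finally show ?thesis .
qed

lemma variation_norm_mono:
  assumes "\<And>A. norm (\<rho> A) \<le> norm (\<nu> A)"
  shows "variation \<rho> E \<le> variation \<nu> E"
  unfolding variation_def by (intro SUP_mono' sum_mono ennreal_leI assms)

lemma complex_measures_iff:
  "\<nu> \<in> complex_measures \<longleftrightarrow> vector_measure \<nu> \<and> (\<forall>A. A \<notin> sets borel \<longrightarrow> \<nu> A = 0) \<and> variation \<nu> UNIV < \<infinity>"
  by (simp add: complex_measures_def vector_measure_def)

text \<open>Everything about \<^const>\<open>complex_integral\<close> is derived from this Riemann-sum estimate. The factor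
  \<open>2\<close> comes from treating the real and the imaginary part separately.\<close>

lemma complex_integral_approx:
  fixes \<nu> :: "'a::topological_space set \<Rightarrow> complex"
  assumes \<nu>: "\<nu> \<in> complex_measures"
    and f: "f \<in> borel_measurable borel"
    and h: "finite (range h)" "\<And>k. h -` {k} \<in> sets borel"
    and approx: "\<And>x. cmod (f x - a (h x)) \<le> e"
  shows "cmod (complex_integral \<nu> f - (\<Sum>k\<in>range h. \<nu> (h -` {k}) * a k)) \<le> 2 * e * tv_norm \<nu>"
proof -
  let ?R = "\<lambda>E. Re (\<nu> E)" and ?I = "\<lambda>E. Im (\<nu> E)"
  have e: "0 \<le> e" using approx norm_ge_zero order_trans by blast
  have vm: "vector_measure ?R" "vector_measure ?I"
    using \<nu> by (auto simp: complex_measures_iff vector_measure_def intro!: sums_Re sums_Im)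
  have le: "variation ?R UNIV \<le> variation \<nu> UNIV" "variation ?I UNIV \<le> variation \<nu> UNIV"
    by (auto intro!: variation_norm_mono simp: abs_Re_le_cmod abs_Im_le_cmod)
  have fin: "variation \<nu> UNIV < \<infinity>" using \<nu> by (simp add: complex_measures_iff)
  have bound: "enn2real (variation ?R UNIV) \<le> tv_norm \<nu>" "enn2real (variation ?I UNIV) \<le> tv_norm \<nu>"
    using le fin by (auto simp: tv_norm_def intro!: enn2real_mono)
  let ?S = "\<lambda>\<rho>. \<Sum>k\<in>range h. of_real (\<rho> (h -` {k})) * a k"
  let ?J = "\<lambda>\<rho>. integral\<^sup>L (pos_variation \<rho>) f - integral\<^sup>L (neg_variation \<rho>) f"
  have R: "cmod (?J ?R - ?S ?R) \<le> e * enn2real (variation ?R UNIV)"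
    using le(1) fin by (intro jordan_integral_approx vm f h approx) (rule le_less_trans)
  have I: "cmod (?J ?I - ?S ?I) \<le> e * enn2real (variation ?I UNIV)"
    using le(2) fin by (intro jordan_integral_approx vm f h approx) (rule le_less_trans)
  have triangle: "cmod (x + \<i> * y) \<le> cmod x + cmod y" for x y
    using norm_triangle_ineq[of x "\<i> * y"] by (simp add: norm_mult)
  have "(\<Sum>k\<in>range h. \<nu> (h -` {k}) * a k) = ?S ?R + \<i> * ?S ?I"
    by (subst complex_eq) (simp add: sum_distrib_left sum.distrib algebra_simps)
  then have eq: "complex_integral \<nu> f - (\<Sum>k\<in>range h. \<nu> (h -` {k}) * a k) =
      (?J ?R - ?S ?R) + \<i> * (?J ?I - ?S ?I)"
    by (simp add: complex_integral_def algebra_simps)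
  have "cmod (complex_integral \<nu> f - (\<Sum>k\<in>range h. \<nu> (h -` {k}) * a k)) \<le>
      cmod (?J ?R - ?S ?R) + cmod (?J ?I - ?S ?I)"
    unfolding eq by (rule triangle)
  also have "\<dots> \<le> e * tv_norm \<nu> + e * tv_norm \<nu>"
    by (intro add_mono order_trans[OF R mult_left_mono[OF bound(1) e]]
        order_trans[OF I mult_left_mono[OF bound(2) e]])
  finally show ?thesis by simp
qed

lemma sum_cmod_le_tv_norm:
  assumes \<nu>: "\<nu> \<in> complex_measures" and h: "finite (range h)" "\<And>k. h -` {k} \<in> sets borel"
  shows "(\<Sum>k\<in>range h. cmod (\<nu> (h -` {k}))) \<le> tv_norm \<nu>"
proof -
  have "ennreal (\<Sum>k\<in>range h. cmod (\<nu> (h -` {k}))) = (\<Sum>k\<in>range h. ennreal (cmod (\<nu> (h -` {k}))))"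
    by (simp add: sum_ennreal)
  also have "\<dots> \<le> variation \<nu> UNIV"
    using \<nu> h by (intro sum_norm_le_variation) (auto simp: complex_measures_iff disjoint_family_on_def)
  finally have "enn2real (ennreal (\<Sum>k\<in>range h. cmod (\<nu> (h -` {k})))) \<le> tv_norm \<nu>"
    unfolding tv_norm_def using \<nu> by (intro enn2real_mono) (auto simp: complex_measures_iff)
  then show ?thesis by (simp add: sum_nonneg)
qed

lemma tv_norm_nonneg: "0 \<le> tv_norm \<nu>"
  by (simp add: tv_norm_def)

text \<open>Cut the square \<open>[-1, 1]\<^sup>2\<close> into cells of side \<open>e / 2\<close> and label a point \<open>x\<close> by the cells that contain
  the finitely many values \<open>f m x\<close>. Points with equal labels have values at distance at most \<open>e\<close>.\<close>

lemma fine_finite_partition: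
  fixes f :: "'i \<Rightarrow> 'a::topological_space \<Rightarrow> complex"
  assumes L: "finite L" and f: "\<And>m. m \<in> L \<Longrightarrow> f m \<in> borel_measurable borel"
    "\<And>m x. m \<in> L \<Longrightarrow> cmod (f m x) \<le> 1" and e: "0 < e"
  obtains h :: "'a \<Rightarrow> 'i \<Rightarrow> int \<times> int" where "finite (range h)" "\<forall>k. h -` {k} \<in> sets borel"
    "\<forall>x y. h x = h y \<longrightarrow> (\<forall>m\<in>L. cmod (f m x - f m y) \<le> e)"
proof -
  define \<delta> where "\<delta> = e / 2"
  have \<delta>: "0 < \<delta>" using e by (simp add: \<delta>_def)
  define h :: "'a \<Rightarrow> 'i \<Rightarrow> int \<times> int" where
    "h x m = (if m \<in> L then (\<lfloor>Re (f m x) / \<delta>\<rfloor>, \<lfloor>Im (f m x) / \<delta>\<rfloor>) else (0, 0))" for x m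
  define G where "G = {\<lfloor>- 1 / \<delta>\<rfloor> .. \<lfloor>1 / \<delta>\<rfloor>}"
  have G: "\<lfloor>r / \<delta>\<rfloor> \<in> G" if "\<bar>r\<bar> \<le> 1" for r
  proof -
    have "- 1 / \<delta> \<le> r / \<delta>" "r / \<delta> \<le> 1 / \<delta>"
      using that \<delta> by (intro divide_right_mono; linarith)+
    then show ?thesis unfolding G_def by (simp only: atLeastAtMost_iff floor_mono simp_thms)
  qed
  have "range h \<subseteq> {g. \<forall>m. (m \<in> L \<longrightarrow> g m \<in> G \<times> G) \<and> (m \<notin> L \<longrightarrow> g m = (0, 0))}"
  proof (clarsimp simp: h_def, intro conjI G)
    fix x m assume "m \<in> L"
    from f(2)[OF this, of x] show "\<bar>Re (f m x)\<bar> \<le> 1" "\<bar>Im (f m x)\<bar> \<le> 1"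
      using abs_Re_le_cmod abs_Im_le_cmod order_trans by blast+
  qed
  moreover have "finite {g. \<forall>m. (m \<in> L \<longrightarrow> g m \<in> G \<times> G) \<and> (m \<notin> L \<longrightarrow> g m = (0::int, 0::int))}"
    by (intro finite_set_of_finite_funs L) (simp add: G_def)
  ultimately have 1: "finite (range h)" by (rule finite_subset)
  have 2: "h -` {k} \<in> sets borel" for k
  proof (cases "\<forall>m. m \<notin> L \<longrightarrow> k m = (0, 0)")
    case True
    define C where "C m = {x \<in> space borel. of_int (fst (k m)) \<le> Re (f m x) / \<delta> \<and>
      Re (f m x) / \<delta> < of_int (fst (k m)) + 1 \<and> of_int (snd (k m)) \<le> Im (f m x) / \<delta> \<and>
      Im (f m x) / \<delta> < of_int (snd (k m)) + 1}" for m
    have C: "C m \<in> sets borel" if "m \<in> L" for m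
    proof -
      note [measurable] = f(1)[OF that]
      show ?thesis unfolding C_def by measurable
    qed
    have "h -` {k} = (\<Inter>m\<in>L. C m) \<inter> space borel"
    proof (intro set_eqI)
      fix x
      have "x \<in> h -` {k} \<longleftrightarrow> (\<forall>m\<in>L. h x m = k m)"
        using True by (auto simp: fun_eq_iff h_def)
      also have "\<dots> \<longleftrightarrow> x \<in> (\<Inter>m\<in>L. C m) \<inter> space borel"
        by (auto simp: C_def h_def prod_eq_iff floor_eq_iff)
      finally show "x \<in> h -` {k} \<longleftrightarrow> x \<in> (\<Inter>m\<in>L. C m) \<inter> space borel" .
    qed
    also have "\<dots> \<in> sets borel"
      using L C by (cases "L = {}") (auto intro!: sets.finite_INT)
    finally show ?thesis .
  next
    case False
    then have "h -` {k} = {}" by (auto simp: h_def fun_eq_iff)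
    then show ?thesis by simp
  qed
  have close: "\<bar>r - s\<bar> \<le> \<delta>" if "\<lfloor>r / \<delta>\<rfloor> = \<lfloor>s / \<delta>\<rfloor>" for r s
  proof -
    have "\<bar>r / \<delta> - s / \<delta>\<bar> \<le> 1" using that by linarith
    then show ?thesis using \<delta> by (simp add: abs_le_iff field_simps)
  qed
  have 3: "cmod (f m x - f m y) \<le> e" if "h x = h y" "m \<in> L" for x y m
  proof -
    have "h x m = h y m" using that by simp
    then have "\<bar>Re (f m x) - Re (f m y)\<bar> \<le> \<delta>" "\<bar>Im (f m x) - Im (f m y)\<bar> \<le> \<delta>"
      using that(2) by (auto simp: h_def intro!: close)
    then show ?thesis using cmod_le[of "f m x - f m y"] by (simp add: \<delta>_def)
  qed
  show thesis using 1 2 3 by (intro that) auto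
qed

section \<open>Discrete measures\<close>

definition discrete_measure ::
    "'i set \<Rightarrow> ('i \<Rightarrow> complex) \<Rightarrow> ('i \<Rightarrow> 'a) \<Rightarrow> 'a::topological_space set \<Rightarrow> complex" where
  "discrete_measure I c p E = (if E \<in> sets borel then \<Sum>i\<in>I. c i * indicator E (p i) else 0)"

text \<open>A point lies in at most one of the sets.\<close>

lemma sum_indicator_disjoint_le:
  assumes "finite P" "disjoint P"
  shows "(\<Sum>A\<in>P. indicator A x) \<le> (1::real)"
proof (cases "\<exists>A\<in>P. x \<in> A")
  case True
  then obtain A where A: "A \<in> P" "x \<in> A" by blast
  have "(\<Sum>B\<in>P. indicator B x) = (\<Sum>B\<in>{A}. indicator B x :: real)"
    using assms A by (intro sum.mono_neutral_right) (auto simp: indicator_def disjoint_def)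
  then show ?thesis by simp
next
  case False
  then have "(\<Sum>B\<in>P. indicator B x) = (0::real)" by (intro sum.neutral) (auto simp: indicator_def)
  then show ?thesis by simp
qed

lemma
  fixes p :: "'i \<Rightarrow> 'a::topological_space"
  assumes I: "finite I"
  shows discrete_measure_in: "discrete_measure I c p \<in> complex_measures"
    and tv_norm_discrete_measure_le: "tv_norm (discrete_measure I c p) \<le> (\<Sum>i\<in>I. cmod (c i))"
proof -
  let ?\<sigma> = "discrete_measure I c p"
  have var: "variation ?\<sigma> UNIV \<le> ennreal (\<Sum>i\<in>I. cmod (c i))"
    unfolding variation_def
  proof (rule SUP_least)
    fix P :: "'a set set"
    assume "P \<in> {P. finite P \<and> P \<subseteq> sets borel \<and> partition_on UNIV P}"
    then have P: "finite P" "P \<subseteq> sets borel" "disjoint P" by (auto simp: partition_on_def)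
    have "(\<Sum>A\<in>P. cmod (?\<sigma> A)) \<le> (\<Sum>A\<in>P. \<Sum>i\<in>I. cmod (c i) * indicator A (p i))"
    proof (intro sum_mono)
      fix A assume "A \<in> P"
      then have "?\<sigma> A = (\<Sum>i\<in>I. c i * indicator A (p i))"
        using P(2) by (auto simp: discrete_measure_def)
      also have "cmod \<dots> \<le> (\<Sum>i\<in>I. cmod (c i) * indicator A (p i))"
        by (intro order_trans[OF norm_sum] sum_mono) (simp add: norm_mult split: split_indicator)
      finally show "cmod (?\<sigma> A) \<le> (\<Sum>i\<in>I. cmod (c i) * indicator A (p i))" .
    qed
    also have "\<dots> = (\<Sum>i\<in>I. cmod (c i) * (\<Sum>A\<in>P. indicator A (p i)))"
      by (subst sum.swap) (simp add: sum_distrib_left)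
    also have "\<dots> \<le> (\<Sum>i\<in>I. cmod (c i) * 1)"
      by (intro sum_mono mult_left_mono sum_indicator_disjoint_le P) auto
    finally have "ennreal (\<Sum>A\<in>P. cmod (?\<sigma> A)) \<le> ennreal (\<Sum>i\<in>I. cmod (c i))"
      by (intro ennreal_leI) simp
    then show "(\<Sum>A\<in>P. ennreal (cmod (?\<sigma> A))) \<le> ennreal (\<Sum>i\<in>I. cmod (c i))"
      by (simp add: sum_ennreal)
  qed
  have "vector_measure ?\<sigma>"
    unfolding vector_measure_def
  proof (intro allI impI)
    fix A :: "nat \<Rightarrow> 'a set" assume A: "range A \<subseteq> sets borel" "disjoint_family A"
    have ind: "(\<lambda>n. indicator (A n) x) sums (indicator (\<Union>n. A n) x :: complex)" for x
    proof (cases "\<exists>n. x \<in> A n")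
      case True
      then obtain n where n: "x \<in> A n" by blast
      have "indicator (A k) x = (if k = n then 1 else 0 :: complex)" for k
        using n disjoint_family_onD[OF A(2), of k n] by (auto simp: indicator_def)
      moreover have "indicator (\<Union>n. A n) x = (1 :: complex)" using n by (auto simp: indicator_def)
      ultimately show ?thesis using sums_single[of n "\<lambda>_. 1::complex"] by simp
    next
      case False
      then show ?thesis by (simp add: indicator_def)
    qed
    have "(\<lambda>n. \<Sum>i\<in>I. c i * indicator (A n) (p i)) sums (\<Sum>i\<in>I. c i * indicator (\<Union>n. A n) (p i))"
      by (intro sums_sum sums_mult ind)
    moreover have "A n \<in> sets borel" for n using A(1) by blast
    moreover from this have "(\<Union>n. A n) \<in> sets borel" by blast
    ultimately show "(\<lambda>n. ?\<sigma> (A n)) sums ?\<sigma> (\<Union>n. A n)"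
      by (simp add: discrete_measure_def)
  qed
  moreover have "variation ?\<sigma> UNIV < \<infinity>" using var by (rule le_less_trans) simp
  ultimately show "?\<sigma> \<in> complex_measures"
    by (simp add: complex_measures_iff discrete_measure_def)
  have "tv_norm ?\<sigma> \<le> enn2real (ennreal (\<Sum>i\<in>I. cmod (c i)))"
    unfolding tv_norm_def by (rule enn2real_mono[OF var]) simp
  then show "tv_norm ?\<sigma> \<le> (\<Sum>i\<in>I. cmod (c i))" by (simp add: sum_nonneg)
qed

text \<open>Compare both sides with the Riemann sum of a fine partition; the sum over the fibres of \<open>h\<close> picks
  for each atom the value of the step function there.\<close>

lemma complex_integral_discrete_measure:
  fixes f :: "'a::topological_space \<Rightarrow> complex"
  assumes I: "finite I" and f: "f \<in> borel_measurable borel" "\<And>x. cmod (f x) \<le> 1"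
  shows "complex_integral (discrete_measure I c p) f = (\<Sum>i\<in>I. c i * f (p i))"
proof -
  let ?\<sigma> = "discrete_measure I c p" and ?C = "\<Sum>i\<in>I. cmod (c i)"
  have "cmod (complex_integral ?\<sigma> f - (\<Sum>i\<in>I. c i * f (p i))) \<le> e" if e: "0 < e" for e
  proof -
    \<comment> \<open>The two comparisons cost \<open>2 * d * ?C\<close> and \<open>d * ?C\<close>; the summand \<open>1\<close> avoids division by zero.\<close>
    define d where "d = e / (3 * ?C + 1)"
    have C: "0 \<le> ?C" by (simp add: sum_nonneg)
    then have d: "0 < d" using e by (simp add: d_def)
    have de: "3 * d * ?C \<le> e"
      using e C by (simp add: d_def field_simps)
    obtain h :: "'a \<Rightarrow> unit \<Rightarrow> int \<times> int"
      where part: "finite (range h)" "\<forall>k. h -` {k} \<in> sets borel"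
        "\<forall>x y. h x = h y \<longrightarrow> (\<forall>m\<in>{()}. cmod (f x - f y) \<le> d)"
      by (rule fine_finite_partition[of "{()}" "\<lambda>_. f" d]) (use f d in auto)
    note h = part(1) part(2)[rule_format]
    have hd: "cmod (f x - f y) \<le> d" if "h x = h y" for x y using part(3) that by simp
    define a where "a k = f (inv h k)" for k
    have a: "cmod (f x - a (h x)) \<le> d" for x
      unfolding a_def by (rule hd) (simp add: f_inv_into_f)
    have "(\<Sum>k\<in>range h. ?\<sigma> (h -` {k}) * a k) = (\<Sum>k\<in>range h. \<Sum>i\<in>I. c i * indicator (h -` {k}) (p i) * a k)"
      by (simp add: discrete_measure_def h(2) sum_distrib_right)
    also have "\<dots> = (\<Sum>i\<in>I. \<Sum>k\<in>range h. if k = h (p i) then c i * a k else 0)"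
      by (subst sum.swap) (intro sum.cong refl, auto simp: indicator_def)
    also have "\<dots> = (\<Sum>i\<in>I. c i * a (h (p i)))"
      using h(1) by simp
    finally have eq: "(\<Sum>k\<in>range h. ?\<sigma> (h -` {k}) * a k) = (\<Sum>i\<in>I. c i * a (h (p i)))" .
    have "cmod ((\<Sum>i\<in>I. c i * a (h (p i))) - (\<Sum>i\<in>I. c i * f (p i))) \<le> (\<Sum>i\<in>I. cmod (c i) * d)"
      unfolding sum_subtractf[symmetric] right_diff_distrib[symmetric]
      using a by (intro order_trans[OF norm_sum] sum_mono) (simp add: norm_mult norm_minus_commute mult_left_mono)
    then have 1: "cmod ((\<Sum>i\<in>I. c i * a (h (p i))) - (\<Sum>i\<in>I. c i * f (p i))) \<le> d * ?C"
      by (simp add: sum_distrib_left mult.commute)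
    have "cmod (complex_integral ?\<sigma> f - (\<Sum>i\<in>I. c i * a (h (p i)))) \<le> 2 * d * tv_norm ?\<sigma>"
      unfolding eq[symmetric]
      by (rule complex_integral_approx) (use discrete_measure_in[OF I] f(1) h a in auto)
    also have "\<dots> \<le> 2 * d * ?C"
      using d by (intro mult_left_mono tv_norm_discrete_measure_le I) simp
    finally have 2: "cmod (complex_integral ?\<sigma> f - (\<Sum>i\<in>I. c i * a (h (p i)))) \<le> 2 * d * ?C" .
    have "cmod (complex_integral ?\<sigma> f - (\<Sum>i\<in>I. c i * f (p i))) \<le> 2 * d * ?C + d * ?C"
      using norm_triangle_mono[OF 2 1] by simp
    also have "\<dots> \<le> e" using de by simp
    finally show ?thesis .
  qed
  then have "cmod (complex_integral ?\<sigma> f - (\<Sum>i\<in>I. c i * f (p i))) \<le> 0"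
    by (rule field_le_epsilon) simp
  then show ?thesis by simp
qed

section \<open>Convex hulls of compact sets in finite-dimensional subspaces\<close>

text \<open>Subtract from \<open>u\<close> a multiple of a linear relation \<open>w\<close> among the elements of \<open>T\<close>: the value of the
  combination does not change. If the coefficients of \<open>w\<close> have nonnegative sum, the total weight does not
  grow, and the largest multiple that keeps all weights nonnegative makes one of them vanish.\<close>

lemma caratheodory_cone_step:
  fixes T :: "'a::real_vector set"
  assumes T: "finite T" "dependent T" and u: "\<And>x. x \<in> T \<Longrightarrow> 0 \<le> u x"
  obtains a v where "a \<in> T" "\<forall>x\<in>T. 0 \<le> v x" "v a = 0" "sum v T \<le> sum u T"
    "(\<Sum>x\<in>T. v x *\<^sub>R x) = (\<Sum>x\<in>T. u x *\<^sub>R x)"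
proof -
  obtain w0 y where w0: "(\<Sum>x\<in>T. w0 x *\<^sub>R x) = 0" "y \<in> T" "w0 y \<noteq> 0"
    using T by (auto simp: dependent_finite)
  \<comment> \<open>Either \<open>w0\<close> or its negative has nonnegative total and a positive entry.\<close>
  have "\<exists>w. (\<Sum>x\<in>T. w x *\<^sub>R x) = 0 \<and> sum w T \<ge> 0 \<and> (\<exists>x\<in>T. w x > 0)"
  proof (cases "sum w0 T > 0 \<or> sum w0 T = 0 \<and> w0 y > 0")
    case True
    then have "\<exists>x\<in>T. w0 x > 0"
      using w0(2) sum_nonpos[of T w0] by force
    with True w0 show ?thesis by (intro exI[of _ w0]) auto
  next
    case False
    then have F: "sum w0 T < 0 \<or> sum w0 T = 0 \<and> w0 y < 0" using w0(3) by linarith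
    then have "\<exists>x\<in>T. - w0 x > 0"
      using w0(2) sum_nonneg[of T w0] by force
    with F w0 show ?thesis by (intro exI[of _ "\<lambda>x. - w0 x"]) (auto simp: sum_negf)
  qed
  then obtain w where w: "(\<Sum>x\<in>T. w x *\<^sub>R x) = 0" "sum w T \<ge> 0" "\<exists>x\<in>T. w x > 0" by blast
  define W where "W = {x\<in>T. w x > 0}"
  have W: "finite W" "W \<noteq> {}" using T w by (auto simp: W_def)
  define t where "t = Min ((\<lambda>x. u x / w x) ` W)"
  have "t \<in> (\<lambda>x. u x / w x) ` W" unfolding t_def using W by (intro Min_in) auto
  then obtain a where a: "a \<in> W" "t = u a / w a" by auto
  have t0: "0 \<le> t" using a u by (auto simp: W_def)
  have tle: "t \<le> u x / w x" if "x \<in> W" for x unfolding t_def using W that by (intro Min_le) auto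
  show ?thesis
  proof (rule that[of a "\<lambda>x. u x - t * w x"])
    show "a \<in> T" using a by (simp add: W_def)
    show "u a - t * w a = 0" using a by (simp add: W_def)
    have "0 \<le> u x - t * w x" if "x \<in> T" for x
    proof (cases "w x > 0")
      case True
      then show ?thesis using tle[of x] that by (auto simp: W_def field_simps)
    next
      case False
      then have "t * w x \<le> 0" using t0 by (simp add: mult_nonneg_nonpos)
      then show ?thesis using u[OF that] by linarith
    qed
    then show "\<forall>x\<in>T. 0 \<le> u x - t * w x" by blast
    show "(\<Sum>x\<in>T. u x - t * w x) \<le> sum u T"
      using w(2) t0 by (simp add: sum_subtractf flip: sum_distrib_left)
    show "(\<Sum>x\<in>T. (u x - t * w x) *\<^sub>R x) = (\<Sum>x\<in>T. u x *\<^sub>R x)"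
    proof -
      have "(\<Sum>x\<in>T. (t * w x) *\<^sub>R x) = t *\<^sub>R (\<Sum>x\<in>T. w x *\<^sub>R x)"
        by (simp add: scaleR_sum_right)
      then show ?thesis using w(1) by (simp add: scaleR_diff_left sum_subtractf)
    qed
  qed
qed

text \<open>Caratheodory's reduction for subconvex combinations. Linear (instead of affine) dependence suffices
  because the total weight may drop, which is harmless for sets that contain \<open>0\<close>.\<close>

lemma caratheodory_cone:
  fixes T :: "'a::real_vector set"
  assumes "finite B" "finite T" "T \<subseteq> span B" "\<And>x. x \<in> T \<Longrightarrow> 0 \<le> u x"
  shows "\<exists>T' v. T' \<subseteq> T \<and> card T' \<le> card B \<and> (\<forall>x\<in>T'. 0 \<le> v x) \<and> sum v T' \<le> sum u T \<and>
    (\<Sum>x\<in>T'. v x *\<^sub>R x) = (\<Sum>x\<in>T. u x *\<^sub>R x)"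
  using assms(2-)
proof (induction "card T" arbitrary: T u)
  case 0
  then show ?case by (intro exI[of _ "{}"]) auto
next
  case (Suc n)
  show ?case
  proof (cases "card T \<le> card B")
    case True
    then show ?thesis using Suc.prems by (intro exI[of _ T] exI[of _ u]) simp
  next
    case False
    have "dependent T"
    proof (rule ccontr)
      assume "independent T"
      from independent_span_bound[OF assms(1) this Suc.prems(2)] False show False by simp
    qed
    obtain a v where v: "a \<in> T" "\<forall>x\<in>T. 0 \<le> v x" "v a = 0" "sum v T \<le> sum u T"
      "(\<Sum>x\<in>T. v x *\<^sub>R x) = (\<Sum>x\<in>T. u x *\<^sub>R x)"
      by (rule caratheodory_cone_step[OF Suc.prems(1) \<open>dependent T\<close>, of u, OF Suc.prems(3)])
    have sums: "sum v (T - {a}) = sum v T"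
      "(\<Sum>x\<in>T-{a}. v x *\<^sub>R x) = (\<Sum>x\<in>T. v x *\<^sub>R x)"
      using Suc.prems(1) v(1,3) by (simp_all add: sum.remove[of T a])
    have "n = card (T - {a})" "finite (T - {a})" "T - {a} \<subseteq> span B"
      using Suc.hyps(2) Suc.prems(1,2) v(1) by auto
    moreover have "\<And>x. x \<in> T - {a} \<Longrightarrow> 0 \<le> v x" using v(2) by blast
    ultimately have "\<exists>T' v'. T' \<subseteq> T - {a} \<and> card T' \<le> card B \<and> (\<forall>x\<in>T'. 0 \<le> v' x) \<and>
        sum v' T' \<le> sum v (T - {a}) \<and> (\<Sum>x\<in>T'. v' x *\<^sub>R x) = (\<Sum>x\<in>T-{a}. v x *\<^sub>R x)"
      by (rule Suc.hyps(1))
    then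
    obtain T' v' where v': "T' \<subseteq> T - {a}" "card T' \<le> card B" "\<forall>x\<in>T'. 0 \<le> v' x"
      "sum v' T' \<le> sum v (T - {a})" "(\<Sum>x\<in>T'. v' x *\<^sub>R x) = (\<Sum>x\<in>T-{a}. v x *\<^sub>R x)"
      by blast
    have "T' \<subseteq> T" "sum v' T' \<le> sum u T" "(\<Sum>x\<in>T'. v' x *\<^sub>R x) = (\<Sum>x\<in>T. u x *\<^sub>R x)"
      using v'(1,4,5) v(4,5) sums by auto
    with v'(2,3) show ?thesis by (intro exI[of _ T'] exI[of _ v']) simp
  qed
qed

text \<open>For \<open>0 \<in> S\<close> this is the set of subconvex combinations of at most \<open>n\<close> points of \<open>S\<close>. The recursion
  follows \<open>compact_convex_combinations\<close>, which makes each stage compact.\<close>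

fun iterated_segments :: "'a::real_vector set \<Rightarrow> nat \<Rightarrow> 'a set" where
  "iterated_segments S 0 = {0}"
| "iterated_segments S (Suc n) =
    {(1 - u) *\<^sub>R x + u *\<^sub>R y | x y u. 0 \<le> u \<and> u \<le> 1 \<and> x \<in> S \<and> y \<in> iterated_segments S n}"

lemma compact_iterated_segments:
  fixes S :: "'a::real_normed_vector set"
  assumes "compact S"
  shows "compact (iterated_segments S n)"
  by (induction n) (simp_all add: compact_convex_combinations assms)

lemma iterated_segments_subset_convex_hull:
  assumes "0 \<in> S"
  shows "iterated_segments S n \<subseteq> convex hull S"
proof (induction n)
  case (Suc n)
  show ?case
  proof
    fix z assume "z \<in> iterated_segments S (Suc n)"
    then obtain x y u where "z = (1 - u) *\<^sub>R x + u *\<^sub>R y" "0 \<le> u" "u \<le> 1" "x \<in> S" "y \<in> convex hull S"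
      using Suc by auto
    then show "z \<in> convex hull S"
      using convexD_alt[of "convex hull S" x y u] by (simp add: hull_inc)
  qed
qed (use assms hull_inc in auto)

lemma subconvex_sum_in_iterated_segments:
  assumes "0 \<in> S" "finite T" "card T \<le> n" "T \<subseteq> S" "\<And>x. x \<in> T \<Longrightarrow> 0 \<le> u x" "sum u T \<le> 1"
  shows "(\<Sum>x\<in>T. u x *\<^sub>R x) \<in> iterated_segments S n"
  using assms(2-)
proof (induction n arbitrary: T u)
  case (Suc n)
  have zero: "0 \<in> iterated_segments S n"
    using Suc.IH[of "{}"] by simp
  show ?case
  proof (cases "T = {}")
    case True
    then show ?thesis using assms(1) zero by (auto intro!: exI[of _ 0])
  next
    case False
    then obtain a where a: "a \<in> T" by blast
    define T' where "T' = T - {a}"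
    have T': "finite T'" "card T' \<le> n" "T' \<subseteq> S" "\<And>x. x \<in> T' \<Longrightarrow> 0 \<le> u x"
      using Suc.prems a by (auto simp: T'_def)
    have split: "(\<Sum>x\<in>T. u x *\<^sub>R x) = u a *\<^sub>R a + (\<Sum>x\<in>T'. u x *\<^sub>R x)" "sum u T = u a + sum u T'"
      unfolding T'_def using Suc.prems(1) a by (simp_all add: sum.remove[of T a])
    have ua: "0 \<le> u a" "a \<in> S" "0 \<le> sum u T'" using a Suc.prems T' by (auto intro: sum_nonneg)
    define v where "v = 1 - u a"
    have v: "0 \<le> v" "v \<le> 1" "sum u T' \<le> v" using Suc.prems(5) split ua by (auto simp: v_def)
    have "\<exists>y\<in>iterated_segments S n. (\<Sum>x\<in>T'. u x *\<^sub>R x) = v *\<^sub>R y"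
    proof (cases "v = 0")
      case True
      then have "\<forall>x\<in>T'. u x = 0" using v(3) ua(3) T' sum_nonneg_eq_0_iff[of T' u] by auto
      then show ?thesis using zero by (intro bexI[of _ 0]) auto
    next
      case False
      have "(\<Sum>x\<in>T'. (u x / v) *\<^sub>R x) \<in> iterated_segments S n"
        using T' v False by (intro Suc.IH) (auto simp flip: sum_divide_distrib)
      moreover have "(\<Sum>x\<in>T'. u x *\<^sub>R x) = v *\<^sub>R (\<Sum>x\<in>T'. (u x / v) *\<^sub>R x)"
        using False by (simp add: scaleR_sum_right)
      ultimately show ?thesis by blast
    qed
    then obtain y where "y \<in> iterated_segments S n" "(\<Sum>x\<in>T'. u x *\<^sub>R x) = v *\<^sub>R y" by blast
    then have "(\<Sum>x\<in>T. u x *\<^sub>R x) = (1 - v) *\<^sub>R a + v *\<^sub>R y" "y \<in> iterated_segments S n"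
      using split by (auto simp: v_def)
    then show ?thesis using ua(2) v(1,2) by auto
  qed
qed auto

text \<open>In infinite dimension the convex hull of a compact set need not be closed. Inside the span of
  \<open>card B\<close> vectors, combinations of \<open>card B\<close> points already give the whole hull.\<close>

lemma compact_convex_hull_finite_span:
  fixes S :: "'a::real_normed_vector set"
  assumes S: "compact S" "0 \<in> S" and B: "finite B" "S \<subseteq> span B"
  shows "compact (convex hull S)"
proof -
  have "convex hull S = iterated_segments S (card B)"
  proof (intro antisym subsetI)
    fix y assume "y \<in> convex hull S"
    then obtain T u where T: "finite T" "T \<subseteq> S" "\<forall>x\<in>T. 0 \<le> u x" "sum u T = 1" "(\<Sum>x\<in>T. u x *\<^sub>R x) = y"
      unfolding convex_hull_explicit by blast
    have "T \<subseteq> span B" using T(2) B(2) by blast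
    from caratheodory_cone[OF B(1) T(1) this, of u] T(3-5)
    obtain T' v where "T' \<subseteq> T" "card T' \<le> card B" "\<forall>x\<in>T'. 0 \<le> v x" "sum v T' \<le> 1"
      "(\<Sum>x\<in>T'. v x *\<^sub>R x) = y"
      by auto
    then show "y \<in> iterated_segments S (card B)"
      using subconvex_sum_in_iterated_segments[OF S(2), of T' "card B" v] T finite_subset[of T' T] by auto
  qed (use iterated_segments_subset_convex_hull[OF S(2)] in auto)
  then show ?thesis using compact_iterated_segments[OF S(1)] by simp
qed

section \<open>Characters of the torus\<close>

lemma abs_rep_circle: "abs_circle (rep_circle z) = z"
  by (rule Quotient3_abs_rep[OF Quotient3_circle])

text \<open>The circle carries the quotient topology, so continuity can be tested after composition with
  \<^const>\<open>abs_circle\<close>, where the representative may be replaced by the given real number.\<close>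

lemma continuous_circle_char:
  "continuous_on UNIV (\<lambda>z. exp (- 2 * of_real pi * \<i> * of_real (of_int k * rep_circle z)))"
  (is "continuous_on UNIV ?g")
proof -
  have lift: "?g (abs_circle r) = exp (- 2 * of_real pi * \<i> * of_real (of_int k * r))" for r
  proof -
    have "rep_circle (abs_circle r) - r \<in> \<int>"
      by (simp add: abs_rep_circle flip: circle.abs_eq_iff)
    then obtain n where n: "rep_circle (abs_circle r) = r + of_int n"
      by (auto elim!: Ints_cases simp: algebra_simps)
    show ?thesis
      unfolding n by (rule exp_eq[THEN iffD2]) (auto intro!: exI[of _ "- k * n"] simp: algebra_simps)
  qed
  have "open (?g -` B)" if "open B" for B
  proof -
    have "continuous_on UNIV (\<lambda>r. ?g (abs_circle r))"
      unfolding lift by (intro continuous_intros)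
    then have "open ((\<lambda>r. ?g (abs_circle r)) -` B)"
      using that by (auto simp: continuous_on_open_vimage)
    then show ?thesis by (simp add: open_circle_def vimage_def)
  qed
  then show ?thesis by (simp add: continuous_on_open_vimage)
qed

text \<open>A character of the torus is a product of characters of the circle in the coordinates.\<close>

lemma borel_measurable_torus_char:
  fixes m :: "int ^ 'd"
  shows "torus_char m \<in> borel_measurable borel"
proof (rule borel_measurable_continuous_onI)
  have "torus_char m = (\<lambda>x. \<Prod>j\<in>UNIV. exp (- 2 * of_real pi * \<i> * of_real (of_int (m $ j) * rep_circle (x $ j))))"
    unfolding torus_char_def of_real_sum sum_distrib_left by (simp add: exp_sum)
  moreover have "continuous_on UNIV (\<lambda>x :: circle ^ 'd.
      \<Prod>j\<in>UNIV. exp (- 2 * of_real pi * \<i> * of_real (of_int (m $ j) * rep_circle (x $ j))))"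
    by (intro continuous_on_prod continuous_on_compose2[OF continuous_circle_char]
        continuous_on_component continuous_on_id) auto
  ultimately show "continuous_on UNIV (torus_char m)" by simp
qed

lemma norm_torus_char: "cmod (torus_char m x) = 1"
  unfolding torus_char_def by (simp add: norm_exp_eq_Re)

section \<open>Fourier coefficients of point masses and their convex hull\<close>

lemma open_int_vec: "open (S :: (int ^ 'd) set)"
  unfolding open_vec_def
proof
  fix x assume "x \<in> S"
  moreover have "y = x" if "\<forall>j. y $ j \<in> {x $ j}" for y :: "int ^ 'd"
    using that by (simp add: vec_eq_iff)
  ultimately show "\<exists>A. (\<forall>j. open (A j) \<and> x $ j \<in> A j) \<and> (\<forall>y. (\<forall>j. y $ j \<in> A j) \<longrightarrow> y \<in> S)"
    by (intro exI[of _ "\<lambda>j. {x $ j}"]) (auto simp: open_discrete)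
qed

text \<open>The restriction of \<open>z\<close> to \<open>\<Lambda>\<close>. The number of frequencies varies, so \<open>\<complex>\<^sup>\<Lambda>\<close> is realized inside one fixed
  normed space, the bounded functions on the discrete space \<open>\<int>\<^sup>d\<close>. Its norm is the maximum norm on \<open>\<Lambda>\<close>.\<close>

definition truncation :: "(int ^ 'd) set \<Rightarrow> (int ^ 'd \<Rightarrow> complex) \<Rightarrow> (int ^ 'd) \<Rightarrow>\<^sub>C complex" where
  "truncation \<Lambda> z = Bcontfun (\<lambda>m. if m \<in> \<Lambda> then z m else 0)"

lemma apply_truncation:
  assumes "finite \<Lambda>"
  shows "apply_bcontfun (truncation \<Lambda> z) m = (if m \<in> \<Lambda> then z m else 0)"
proof -
  have "range (\<lambda>m. if m \<in> \<Lambda> then z m else 0) \<subseteq> insert 0 (z ` \<Lambda>)" by auto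
  then have "finite (range (\<lambda>m. if m \<in> \<Lambda> then z m else 0))"
    by (rule finite_subset) (use assms in simp)
  then have "(\<lambda>m. if m \<in> \<Lambda> then z m else 0) \<in> bcontfun"
    by (simp add: bcontfun_def continuous_on_open_vimage open_int_vec finite_imp_bounded)
  then show ?thesis by (simp add: truncation_def Bcontfun_inverse)
qed

lemma apply_bcontfun_sum: "apply_bcontfun (\<Sum>i\<in>I. f i) x = (\<Sum>i\<in>I. apply_bcontfun (f i) x)"
  by (induction I rule: infinite_finite_induct) (simp_all add: zero_bcontfun.rep_eq plus_bcontfun.rep_eq)

text \<open>The coordinate expression shows both that truncations span a finite-dimensional space and that they
  depend continuously on each \<open>z m\<close>.\<close>

lemma truncation_basis:
  assumes "finite \<Lambda>"
  shows "truncation \<Lambda> z = (\<Sum>m\<in>\<Lambda>. Re (z m) *\<^sub>R truncation {m} (\<lambda>_. 1) + Im (z m) *\<^sub>R truncation {m} (\<lambda>_. \<i>))"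
proof (rule bcontfun_eqI)
  fix k
  have "(\<Sum>m\<in>\<Lambda>. Re (z m) *\<^sub>R (if k = m then 1 else 0) + Im (z m) *\<^sub>R (if k = m then \<i> else 0)) =
      (\<Sum>m\<in>\<Lambda>. if k = m then z m else 0)"
    by (intro sum.cong refl) (auto simp: complex_eq_iff)
  then show "apply_bcontfun (truncation \<Lambda> z) k = apply_bcontfun
      (\<Sum>m\<in>\<Lambda>. Re (z m) *\<^sub>R truncation {m} (\<lambda>_. 1) + Im (z m) *\<^sub>R truncation {m} (\<lambda>_. \<i>)) k"
    using assms by (simp add: apply_truncation apply_bcontfun_sum plus_bcontfun.rep_eq scaleR_bcontfun.rep_eq)
qed

lemma truncation_scaleR: "finite \<Lambda> \<Longrightarrow> r *\<^sub>R truncation \<Lambda> z = truncation \<Lambda> (\<lambda>m. r *\<^sub>R z m)"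
  by (rule bcontfun_eqI) (simp add: apply_truncation scaleR_bcontfun.rep_eq)

lemma truncation_sum: "finite \<Lambda> \<Longrightarrow> (\<Sum>i\<in>I. truncation \<Lambda> (z i)) = truncation \<Lambda> (\<lambda>m. \<Sum>i\<in>I. z i m)"
  by (rule bcontfun_eqI) (simp add: apply_truncation apply_bcontfun_sum)

lemma truncation_eq_iff:
  "finite \<Lambda> \<Longrightarrow> truncation \<Lambda> z = truncation \<Lambda> w \<longleftrightarrow> (\<forall>m\<in>\<Lambda>. z m = w m)"
  by (auto simp: apply_truncation intro!: bcontfun_eqI) (metis apply_truncation)

lemma dist_truncation_le:
  assumes "finite \<Lambda>" "\<And>m. m \<in> \<Lambda> \<Longrightarrow> cmod (z m - w m) \<le> e" "0 \<le> e"
  shows "dist (truncation \<Lambda> z) (truncation \<Lambda> w) \<le> e"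
  using assms by (intro dist_bound) (auto simp: apply_truncation dist_norm)

lemma norm_truncation_le_iff:
  assumes "finite \<Lambda>" "0 \<le> e"
  shows "norm (truncation \<Lambda> z) \<le> e \<longleftrightarrow> (\<forall>m\<in>\<Lambda>. cmod (z m) \<le> e)"
proof
  assume *: "norm (truncation \<Lambda> z) \<le> e"
  show "\<forall>m\<in>\<Lambda>. cmod (z m) \<le> e"
  proof
    fix m assume "m \<in> \<Lambda>"
    then show "cmod (z m) \<le> e"
      using norm_bounded[of "truncation \<Lambda> z" m] * assms by (simp add: apply_truncation)
  qed
qed (use assms in \<open>auto intro!: norm_bound simp: apply_truncation\<close>)

text \<open>The Fourier coefficients on \<open>\<Lambda>\<close> of the point masses \<open>c \<delta>\<^sub>x\<close> of norm at most \<open>1\<close>. Admitting \<open>|c| < 1\<close> as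
  well puts \<open>0\<close> into the set.\<close>

definition dirac_spectra :: "(int ^ 'd) set \<Rightarrow> ((int ^ 'd) \<Rightarrow>\<^sub>C complex) set" where
  "dirac_spectra \<Lambda> = {truncation \<Lambda> (\<lambda>m. c * torus_char m x) | c x. cmod c \<le> 1}"

lemma dirac_spectraI: "cmod c \<le> 1 \<Longrightarrow> truncation \<Lambda> (\<lambda>m. c * torus_char m x) \<in> dirac_spectra \<Lambda>"
  by (auto simp: dirac_spectra_def)

lemma zero_in_dirac_spectra:
  assumes "finite \<Lambda>"
  shows "0 \<in> dirac_spectra \<Lambda>"
proof -
  have "truncation \<Lambda> (\<lambda>m. 0 * torus_char m undefined) = 0"
    using assms by (intro bcontfun_eqI) (simp add: apply_truncation zero_bcontfun.rep_eq)
  then show ?thesis using dirac_spectraI[of 0 \<Lambda> undefined] by simp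
qed

text \<open>The fractional parts of any representatives of the coordinates serve.\<close>

lemma torus_fundamental_domain:
  fixes x :: "circle ^ 'd"
  obtains t :: "real ^ 'd" where "t \<in> cbox 0 (\<chi> j. 1)" "x = (\<chi> j. abs_circle (t $ j))"
proof
  let ?t = "\<chi> j. frac (rep_circle (x $ j)) :: real ^ 'd"
  show "?t \<in> cbox 0 (\<chi> j. 1)" by (simp add: mem_box_cart frac_lt_1 less_imp_le)
  have "abs_circle (frac r) = abs_circle r" for r
    by (simp add: circle.abs_eq_iff frac_def)
  then show "x = (\<chi> j. abs_circle (?t $ j))" by (simp add: abs_rep_circle vec_eq_iff)
qed

text \<open>It is a continuous image of the compact set of all \<open>(c, t)\<close> with \<open>|c| \<le> 1\<close> and \<open>t \<in> [0, 1]\<^sup>d\<close>.\<close>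

lemma compact_dirac_spectra:
  fixes \<Lambda> :: "(int ^ 'd) set"
  assumes "finite \<Lambda>"
  shows "compact (dirac_spectra \<Lambda>)"
proof -
  let ?\<chi> = "\<lambda>m (t :: real ^ 'd). exp (- 2 * of_real pi * \<i> * of_real (\<Sum>j\<in>UNIV. of_int (m $ j) * (t $ j)))"
  let ?F = "\<lambda>p. truncation \<Lambda> (\<lambda>m. fst p * ?\<chi> m (snd p))"
  have "continuous_on UNIV ?F"
    unfolding truncation_basis[OF assms] by (intro continuous_intros)
  then have "compact (?F ` (cball 0 1 \<times> cbox 0 (\<chi> j. 1)))"
    by (intro compact_continuous_image compact_Times compact_cball compact_cbox)
      (auto intro: continuous_on_subset)
  also have "?F ` (cball 0 1 \<times> cbox 0 (\<chi> j. 1)) = dirac_spectra \<Lambda>"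
  proof (intro antisym subsetI)
    fix y assume "y \<in> ?F ` (cball 0 1 \<times> cbox 0 (\<chi> j. 1))"
    then obtain c t where "cmod c \<le> 1" "y = truncation \<Lambda> (\<lambda>m. c * ?\<chi> m t)"
      by (auto simp: image_iff)
    then show "y \<in> dirac_spectra \<Lambda>"
      unfolding torus_char_abs_circle[symmetric] by (simp add: dirac_spectraI)
  next
    fix y assume "y \<in> dirac_spectra \<Lambda>"
    then obtain c x where y: "cmod c \<le> 1" "y = truncation \<Lambda> (\<lambda>m. c * torus_char m x)"
      by (auto simp: dirac_spectra_def)
    obtain t where t: "t \<in> cbox 0 (\<chi> j. 1)" "x = (\<chi> j. abs_circle (t $ j))"
      by (rule torus_fundamental_domain)
    have "y = ?F (c, t)" unfolding y(2) t(2) torus_char_abs_circle by simp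
    moreover have "(c, t) \<in> cball 0 1 \<times> cbox 0 (\<chi> j. 1)" using y(1) t(1) by simp
    ultimately show "y \<in> ?F ` (cball 0 1 \<times> cbox 0 (\<chi> j. 1))" by (rule image_eqI)
  qed
  finally show ?thesis .
qed

lemma compact_convex_hull_dirac_spectra:
  assumes "finite \<Lambda>"
  shows "compact (convex hull dirac_spectra \<Lambda>)"
proof (rule compact_convex_hull_finite_span)
  let ?B = "(\<lambda>(m, w). truncation {m} (\<lambda>_. w)) ` (\<Lambda> \<times> {1, \<i>})"
  show "finite ?B" using assms by simp
  have "truncation \<Lambda> z \<in> span ?B" for z
    unfolding truncation_basis[OF assms]
    by (intro span_sum span_add span_scale span_base image_eqI[of _ _ "(_, 1)"] image_eqI[of _ _ "(_, \<i>)"]) auto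
  then show "dirac_spectra \<Lambda> \<subseteq> span ?B" by (auto simp: dirac_spectra_def)
qed (use assms compact_dirac_spectra zero_in_dirac_spectra in auto)

lemma norm_convex_hull_dirac_spectra_le:
  assumes "finite \<Lambda>" "k \<in> convex hull dirac_spectra \<Lambda>"
  shows "norm k \<le> 1"
proof -
  have "convex hull dirac_spectra \<Lambda> \<subseteq> cball 0 1"
    using assms(1) by (intro hull_minimal)
      (auto simp: dirac_spectra_def norm_truncation_le_iff norm_mult norm_torus_char)
  then show ?thesis using assms(2) by auto
qed

section \<open>Minimal extrapolations\<close>

text \<open>A convex set that contains \<open>0\<close> absorbs combinations of total weight below \<open>1\<close>. Stating this with
  the factor \<open>t\<close> outside also covers \<open>t = 0\<close>, which occurs for the zero measure.\<close>

lemma scaled_convex_sum: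
  assumes K: "convex K" "0 \<in> K" and I: "finite I"
    and w: "\<And>i. i \<in> I \<Longrightarrow> 0 \<le> w i" "sum w I \<le> t" and y: "\<And>i. i \<in> I \<Longrightarrow> y i \<in> K"
  obtains k where "k \<in> K" "(\<Sum>i\<in>I. w i *\<^sub>R y i) = t *\<^sub>R k"
proof (cases "sum w I = 0")
  case True
  then have "\<forall>i\<in>I. w i = 0" using I w(1) sum_nonneg_eq_0_iff[of I w] by auto
  then show thesis using that[of 0] K(2) by simp
next
  case False
  define s where "s = sum w I"
  have s: "0 < s" "s \<le> t" using False w sum_nonneg[of I w] by (auto simp: s_def less_le)
  define z where "z = (\<Sum>i\<in>I. (w i / s) *\<^sub>R y i)"
  have "z \<in> K"
    unfolding z_def using I K(1) w(1) y s
    by (intro convex_sum) (auto simp: s_def simp flip: sum_divide_distrib)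
  then have "(s / t) *\<^sub>R z \<in> K"
    using convexD_alt[OF K(1,2), of z "s / t"] s by simp
  moreover have "(\<Sum>i\<in>I. w i *\<^sub>R y i) = t *\<^sub>R ((s / t) *\<^sub>R z)"
    using s by (simp add: z_def scaleR_sum_right)
  ultimately show thesis by (rule that)
qed

text \<open>On a partition that is fine for all characters in \<open>\<Lambda>\<close>, replace \<open>\<nu>\<close> by the point masses \<open>\<nu> A\<close> placed
  at one point of each member \<open>A\<close>. This changes the coefficients by at most \<open>e\<close>, and the total mass of
  these point masses is at most the norm of \<open>\<nu>\<close>.\<close>

lemma fourier_coeff_approx_hull:
  fixes \<nu> :: "(circle ^ 'd) set \<Rightarrow> complex"
  assumes \<Lambda>: "finite \<Lambda>" and \<nu>: "\<nu> \<in> complex_measures" and e: "0 < e"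
  obtains k where "k \<in> convex hull dirac_spectra \<Lambda>"
    "dist (truncation \<Lambda> (fourier_coeff \<nu>)) (tv_norm \<nu> *\<^sub>R k) \<le> e"
proof -
  let ?t = "tv_norm \<nu>"
  \<comment> \<open>The Riemann-sum estimate with tolerance \<open>d\<close> costs \<open>2 * d * ?t\<close>.\<close>
  define d where "d = e / (2 * ?t + 1)"
  have d: "0 < d" "2 * d * ?t \<le> e"
    using e tv_norm_nonneg[of \<nu>] by (auto simp: d_def field_simps)
  obtain h :: "circle ^ 'd \<Rightarrow> int ^ 'd \<Rightarrow> int \<times> int"
    where part: "finite (range h)" "\<forall>k. h -` {k} \<in> sets borel"
      "\<forall>x y. h x = h y \<longrightarrow> (\<forall>m\<in>\<Lambda>. cmod (torus_char m x - torus_char m y) \<le> d)"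
    by (rule fine_finite_partition[where f=torus_char,
          OF \<Lambda> borel_measurable_torus_char norm_torus_char[THEN eq_refl] d(1)])
  note h = part(1) part(2)[rule_format]
  define c where "c k = \<nu> (h -` {k})" for k
  define S where "S m = (\<Sum>k\<in>range h. c k * torus_char m (inv h k))" for m
  have "cmod (fourier_coeff \<nu> m - S m) \<le> e" if "m \<in> \<Lambda>" for m
  proof -
    have "cmod (torus_char m x - torus_char m (inv h (h x))) \<le> d" for x
      using part(3) that by (simp add: f_inv_into_f)
    then have "cmod (fourier_coeff \<nu> m - S m) \<le> 2 * d * ?t"
      unfolding fourier_coeff_def S_def c_def
      by (rule complex_integral_approx[OF \<nu> borel_measurable_torus_char h, where a="\<lambda>k. torus_char m (inv h k)"])
    then show ?thesis using d(2) by linarith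
  qed
  then have close: "dist (truncation \<Lambda> (fourier_coeff \<nu>)) (truncation \<Lambda> S) \<le> e"
    using \<Lambda> e by (intro dist_truncation_le) auto
  \<comment> \<open>The mass \<open>c k\<close> splits into its weight \<open>cmod (c k)\<close> and its phase \<open>sgn (c k)\<close>.\<close>
  define y where "y k = truncation \<Lambda> (\<lambda>m. sgn (c k) * torus_char m (inv h k))" for k
  have polar: "cmod z *\<^sub>R (sgn z * w) = z * w" for z w
    by (cases "z = 0") (simp_all add: sgn_eq scaleR_conv_of_real)
  have "truncation \<Lambda> S = (\<Sum>k\<in>range h. cmod (c k) *\<^sub>R y k)"
    unfolding y_def truncation_scaleR[OF \<Lambda>] truncation_sum[OF \<Lambda>]
    by (simp add: polar S_def[abs_def])
  moreover obtain k where "k \<in> convex hull dirac_spectra \<Lambda>" "(\<Sum>k\<in>range h. cmod (c k) *\<^sub>R y k) = ?t *\<^sub>R k"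
  proof (rule scaled_convex_sum[OF convex_convex_hull _ h(1)])
    show "(\<Sum>k\<in>range h. cmod (c k)) \<le> ?t"
      unfolding c_def by (rule sum_cmod_le_tv_norm[OF \<nu> h])
    show "y k \<in> convex hull dirac_spectra \<Lambda>" for k
      unfolding y_def by (intro hull_inc dirac_spectraI) (simp add: norm_sgn)
    show "0 \<in> convex hull dirac_spectra \<Lambda>"
      by (intro hull_inc zero_in_dirac_spectra \<Lambda>)
  qed auto
  ultimately show thesis using close that by metis
qed

text \<open>A convex combination of spectra of point masses is the spectrum of the corresponding discrete measure.\<close>

lemma hull_point_measure:
  assumes \<Lambda>: "finite \<Lambda>" and k: "k \<in> convex hull dirac_spectra \<Lambda>" and r: "0 \<le> r"
  obtains \<sigma> where "\<sigma> \<in> complex_measures" "tv_norm \<sigma> \<le> r"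
    "truncation \<Lambda> (fourier_coeff \<sigma>) = r *\<^sub>R k"
proof -
  obtain T u where T: "finite T" "T \<subseteq> dirac_spectra \<Lambda>" "\<forall>s\<in>T. 0 \<le> u s" "sum u T = 1"
      "(\<Sum>s\<in>T. u s *\<^sub>R s) = k"
    using k unfolding convex_hull_explicit by blast
  have "\<forall>s\<in>T. \<exists>p. cmod (fst p) \<le> 1 \<and> s = truncation \<Lambda> (\<lambda>m. fst p * torus_char m (snd p))"
    using T(2) by (force simp: dirac_spectra_def)
  then obtain p where p: "\<And>s. s \<in> T \<Longrightarrow> cmod (fst (p s)) \<le> 1"
      "\<And>s. s \<in> T \<Longrightarrow> s = truncation \<Lambda> (\<lambda>m. fst (p s) * torus_char m (snd (p s)))"
    by metis
  define c where "c s = of_real (r * u s) * fst (p s)" for s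
  let ?\<sigma> = "discrete_measure T c (\<lambda>s. snd (p s))"
  have "tv_norm ?\<sigma> \<le> (\<Sum>s\<in>T. cmod (c s))"
    by (rule tv_norm_discrete_measure_le[OF T(1)])
  also have "\<dots> \<le> (\<Sum>s\<in>T. r * u s)"
    using T(3) r p(1) by (intro sum_mono) (simp add: c_def norm_mult mult_left_le)
  also have "\<dots> = r" using T(4) by (simp flip: sum_distrib_left)
  finally have tv: "tv_norm ?\<sigma> \<le> r" .
  have "fourier_coeff ?\<sigma> = (\<lambda>m. \<Sum>s\<in>T. c s * torus_char m (snd (p s)))"
    unfolding fourier_coeff_def
    by (intro ext complex_integral_discrete_measure T(1) borel_measurable_torus_char) (simp add: norm_torus_char)
  then have "truncation \<Lambda> (fourier_coeff ?\<sigma>) =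
      (\<Sum>s\<in>T. (r * u s) *\<^sub>R truncation \<Lambda> (\<lambda>m. fst (p s) * torus_char m (snd (p s))))"
    by (simp add: truncation_scaleR[OF \<Lambda>] truncation_sum[OF \<Lambda>] c_def scaleR_conv_of_real mult.assoc)
  also have "\<dots> = (\<Sum>s\<in>T. (r * u s) *\<^sub>R s)"
    using p(2) by (intro sum.cong refl) simp
  also have "\<dots> = r *\<^sub>R k"
    by (simp add: scaleR_sum_right flip: T(5))
  finally show thesis using that[OF discrete_measure_in[OF T(1)] tv] by blast
qed

text \<open>The hull lies in the closed unit ball, and the coefficients of \<open>\<nu>\<close> lie arbitrarily close to its
  multiple by the norm of \<open>\<nu>\<close>.\<close>

lemma norm_truncation_fourier_coeff_le:
  assumes "finite \<Lambda>" "\<nu> \<in> complex_measures"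
  shows "norm (truncation \<Lambda> (fourier_coeff \<nu>)) \<le> tv_norm \<nu>"
proof (rule field_le_epsilon)
  fix e :: real assume "0 < e"
  then obtain k where k: "k \<in> convex hull dirac_spectra \<Lambda>"
    "dist (truncation \<Lambda> (fourier_coeff \<nu>)) (tv_norm \<nu> *\<^sub>R k) \<le> e"
    using fourier_coeff_approx_hull[OF assms] by blast
  have "norm (tv_norm \<nu> *\<^sub>R k) \<le> tv_norm \<nu>"
    using norm_convex_hull_dirac_spectra_le[OF assms(1) k(1)] tv_norm_nonneg[of \<nu>]
    by (simp add: mult_left_le)
  then show "norm (truncation \<Lambda> (fourier_coeff \<nu>)) \<le> tv_norm \<nu> + e"
    using k(2) norm_triangle_ineq2[of "truncation \<Lambda> (fourier_coeff \<nu>)" "tv_norm \<nu> *\<^sub>R k"]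
    unfolding dist_norm by linarith
qed

lemma linf_norm_fourier_coeff_le:
  assumes "finite \<Lambda>" "is_extrapolation \<mu> \<Lambda> \<nu>"
  shows "linf_norm \<Lambda> (fourier_coeff \<mu>) \<le> tv_norm \<nu>"
proof -
  have "\<forall>m\<in>\<Lambda>. cmod (fourier_coeff \<nu> m) \<le> tv_norm \<nu>"
    using norm_truncation_fourier_coeff_le[of \<Lambda> \<nu>] assms
    by (simp add: norm_truncation_le_iff tv_norm_nonneg is_extrapolation_def)
  then show ?thesis
    using assms(2) unfolding linf_norm_def is_extrapolation_def
    by (intro cSup_least) (auto simp: tv_norm_nonneg)
qed

text \<open>Let \<open>r\<close> be the infimum of the norms of the extrapolations and \<open>K\<close> the compact hull. An extrapolation of
  norm close to \<open>r\<close> puts the prescribed coefficients close to \<open>r K\<close>. As \<open>r K\<close> is closed, they belong to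
  it, so a discrete measure of norm at most \<open>r\<close> has them.\<close>

lemma minimal_extrapolation_exists:
  assumes \<Lambda>: "finite \<Lambda>" and \<mu>: "\<mu> \<in> complex_measures"
  obtains \<sigma> where "is_extrapolation \<mu> \<Lambda> \<sigma>"
    "\<forall>\<nu>. is_extrapolation \<mu> \<Lambda> \<nu> \<longrightarrow> tv_norm \<sigma> \<le> tv_norm \<nu>"
proof -
  let ?K = "convex hull dirac_spectra \<Lambda>" and ?v = "truncation \<Lambda> (fourier_coeff \<mu>)"
  define N where "N = tv_norm ` {\<nu>. is_extrapolation \<mu> \<Lambda> \<nu>}"
  define r where "r = Inf N"
  have "is_extrapolation \<mu> \<Lambda> \<mu>" using \<mu> by (simp add: is_extrapolation_def)
  then have ne: "N \<noteq> {}" by (auto simp: N_def)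
  have lower: "0 \<le> x" if "x \<in> N" for x using that by (auto simp: N_def tv_norm_nonneg)
  then have bdd: "bdd_below N" by (rule bdd_belowI)
  have r: "0 \<le> r" unfolding r_def by (rule cInf_greatest[OF ne lower])
  have r_le: "r \<le> tv_norm \<nu>" if "is_extrapolation \<mu> \<Lambda> \<nu>" for \<nu>
    unfolding r_def using that bdd by (intro cInf_lower) (auto simp: N_def)
  have "?v \<in> closure ((\<lambda>k. r *\<^sub>R k) ` ?K)"
    unfolding closure_approachable
  proof (intro allI impI)
    fix e :: real assume e: "0 < e"
    obtain \<nu> where \<nu>: "is_extrapolation \<mu> \<Lambda> \<nu>" "tv_norm \<nu> < r + e / 2"
      using cInf_lessD[OF ne, of "r + e / 2"] e by (auto simp: N_def r_def)
    have vm: "\<nu> \<in> complex_measures" using \<nu>(1) by (simp add: is_extrapolation_def)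
    have v: "truncation \<Lambda> (fourier_coeff \<nu>) = ?v"
      using \<nu>(1) by (simp add: truncation_eq_iff[OF \<Lambda>] is_extrapolation_def)
    have "0 < e / 2" using e by simp
    then obtain k where k: "k \<in> ?K" "dist ?v (tv_norm \<nu> *\<^sub>R k) \<le> e / 2"
      using fourier_coeff_approx_hull[OF \<Lambda> vm] unfolding v by blast
    have "dist (tv_norm \<nu> *\<^sub>R k) (r *\<^sub>R k) = (tv_norm \<nu> - r) * norm k"
      using r_le[OF \<nu>(1)] by (simp add: dist_norm flip: scaleR_diff_left)
    also have "\<dots> \<le> (tv_norm \<nu> - r) * 1"
      using r_le[OF \<nu>(1)] norm_convex_hull_dirac_spectra_le[OF \<Lambda> k(1)] by (intro mult_left_mono) auto
    finally have "dist (tv_norm \<nu> *\<^sub>R k) (r *\<^sub>R k) < e / 2" using \<nu>(2) by simp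
    then have "dist (r *\<^sub>R k) ?v < e"
      using k(2) dist_triangle[of ?v "r *\<^sub>R k" "tv_norm \<nu> *\<^sub>R k"] by (simp add: dist_commute)
    then show "\<exists>y\<in>(\<lambda>k. r *\<^sub>R k) ` ?K. dist y ?v < e" using k(1) by blast
  qed
  moreover have "closed ((\<lambda>k. r *\<^sub>R k) ` ?K)"
    by (intro compact_imp_closed compact_scaling compact_convex_hull_dirac_spectra \<Lambda>)
  ultimately obtain k where k: "k \<in> ?K" "?v = r *\<^sub>R k" by auto
  obtain \<sigma> where \<sigma>: "\<sigma> \<in> complex_measures" "tv_norm \<sigma> \<le> r" "truncation \<Lambda> (fourier_coeff \<sigma>) = r *\<^sub>R k"
    by (rule hull_point_measure[OF \<Lambda> k(1) r])
  have "is_extrapolation \<mu> \<Lambda> \<sigma>"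
    using \<sigma>(1,3) k(2) by (simp add: is_extrapolation_def flip: truncation_eq_iff[OF \<Lambda>])
  moreover have "\<forall>\<nu>. is_extrapolation \<mu> \<Lambda> \<nu> \<longrightarrow> tv_norm \<sigma> \<le> tv_norm \<nu>"
    using \<sigma>(2) r_le order_trans by blast
  ultimately show thesis by (rule that)
qed

theorem proposition2p4:
  fixes \<mu> :: "(circle ^ 'd) set \<Rightarrow> complex" and \<Lambda> :: "(int ^ 'd) set"
  assumes "\<mu> \<in> complex_measures" and "finite \<Lambda>"
  shows "linf_norm \<Lambda> (fourier_coeff \<mu>) \<le> min_extrapolation_norm \<mu> \<Lambda>
       \<and> min_extrapolation_norm \<mu> \<Lambda> \<le> tv_norm \<mu>
       \<and> (\<forall>\<nu>. is_extrapolation \<mu> \<Lambda> \<nu> \<and> tv_norm \<nu> < tv_norm \<mu> \<longrightarrow>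
             linf_norm \<Lambda> (fourier_coeff \<mu>) \<le> min_extrapolation_norm \<mu> \<Lambda>
           \<and> min_extrapolation_norm \<mu> \<Lambda> \<le> tv_norm \<nu>
           \<and> tv_norm \<nu> < tv_norm \<mu>)"
proof -
  obtain \<sigma> where \<sigma>: "is_extrapolation \<mu> \<Lambda> \<sigma>"
    and minimal: "\<forall>\<nu>. is_extrapolation \<mu> \<Lambda> \<nu> \<longrightarrow> tv_norm \<sigma> \<le> tv_norm \<nu>"
    by (rule minimal_extrapolation_exists[OF assms(2,1)])
  have eq: "min_extrapolation_norm \<mu> \<Lambda> = tv_norm \<sigma>"
    unfolding min_extrapolation_norm_def
    by (rule Least_equality) (use \<sigma> minimal in auto)
  have "is_extrapolation \<mu> \<Lambda> \<mu>"
    using assms(1) by (simp add: is_extrapolation_def)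
  then show ?thesis
    unfolding eq using linf_norm_fourier_coeff_le[OF assms(2) \<sigma>] minimal by blast
qed

end
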